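(* The compact manifold $M^6=S_{1,\frac{\pi}{2}}/\Gamma$ does not admit any Kähler metric.
   Context: The group. $S_{1,\frac{\pi}{2}}$ is the simply-connected solvable Lie group whose Lie algebra has a basis of left-invariant 1-forms $e^1,\dots,e^6$ with structure equations $$de^1=e^1\wedge e^2,\quad de^2=0,\quad de^3=\tfrac12 e^2\wedge e^3,\quad de^4=\tfrac12 e^2\wedge e^4,\quad de^5=\tfrac{\pi}{2}e^2\wedge e^6,\quad de^6=-\tfrac{\pi}{2}e^2\wedge e^5.$$ The subgroup $\Gamma$ and the manifold $M^6$. Let $(m_{jk})\in SL(3,\mathbb{Z})$ be a matrix with two complex conjugate (non-real) eigenvalues $\alpha,\overline{\alpha}$ and an irrational eigenvalue $c>1$ such that $|\alpha|^2c=1$. Let $(\alpha_1,\alpha_2,\alpha_3)$ be an eigenvector corresponding to $\alpha$ and $(c_1,c_2,c_3)$ a real eigenvector corresponding to $c$, so that $(c\,c_j,\alpha\,\alpha_j)=\sum_{k=1}^3 m_{jk}(c_k,\alpha_k)$ for $j=1,2,3$; the vectors $(c_j,\alpha_j)$ are linearly independent over $\mathbb{R}$. The group $S_{1,\frac{\pi}{2}}$ is taken to be isomorphic to, and is identified with, $\mathbb{R}^6=\mathbb{R}\ltimes(\mathbb{R}\times\mathbb{C}\times\mathbb{C})$ with product $$(t,u,z,w)*(t',u',z',w')=(t+t',\,c^tu'+u,\,\alpha^tz'+z,\,e^{i\frac{\pi}{2}t}w'+w).$$ Under this identification $\Gamma\cong\mathbb{Z}\ltimes(\mathbb{Z}^3\times\mathbb{Z}^2)$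 is the uniform discrete subgroup of $S_{1,\frac{\pi}{2}}$ generated by the transformations $$g_0:(t,u,z,w)\mapsto(t+1,cu,\alpha z,iw),\qquad g_j:(t,u,z,w)\mapsto(t,u+c_j,z+\alpha_j,w)\ (j=1,2,3),$$ $$g_4:(t,u,z,w)\mapsto(t,u,z,w+1),\qquad g_5:(t,u,z,w)\mapsto(t,u,z,w+i),$$ and $M^6=S_{1,\frac{\pi}{2}}/\Gamma$ is the compact quotient. *)

theory Defs
  imports "HOL-Analysis.Analysis" "HOL-Algebra.Coset" "HOL-Algebra.Generated_Groups"
begin

section \<open>Smooth maps and vector fields on open subsets of a Euclidean space\<close>

primrec differentiable_of_order_on ::
    "nat \<Rightarrow> ('a::euclidean_space \<Rightarrow> 'b::euclidean_space) \<Rightarrow> 'a set \<Rightarrow> bool" where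
  "differentiable_of_order_on 0 f S \<longleftrightarrow> continuous_on S f"
| "differentiable_of_order_on (Suc n) f S \<longleftrightarrow>
     (\<forall>x\<in>S. f differentiable (at x)) \<and>
     (\<forall>v. differentiable_of_order_on n (\<lambda>x. frechet_derivative f (at x) v) S)"

definition smooth_on :: "'a set \<Rightarrow> ('a::euclidean_space \<Rightarrow> 'b::euclidean_space) \<Rightarrow> bool" where
  "smooth_on S f \<longleftrightarrow> (\<forall>n. differentiable_of_order_on n f S)"

definition lie_bracket ::
    "('a::euclidean_space \<Rightarrow> 'a) \<Rightarrow> ('a \<Rightarrow> 'a) \<Rightarrow> 'a \<Rightarrow> 'a" where
  "lie_bracket X Y p = frechet_derivative Y (at p) (X p) - frechet_derivative X (at p) (Y p)"


section \<open>Tensor fields on a manifold given by an atlas\<close>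

text \<open>
  A chart is a pair of its domain and its coordinate map; outside the domain the coordinate map
  is irrelevant. An atlas consists of injective charts with open images whose domains cover the
  manifold and whose transition maps are smooth with open domains; the topology of the manifold is
  the one for which the charts are homeomorphisms. Tensor fields are described in the classical
  way, by their components in each chart of the atlas, subject to the transformation law.
\<close>

type_synonym ('m, 'e) chart = "'m set \<times> ('m \<Rightarrow> 'e)"

definition chart_dom :: "('m, 'e) chart \<Rightarrow> 'm set" where
  "chart_dom \<kappa> = fst \<kappa>"

definition chart_map :: "('m, 'e) chart \<Rightarrow> 'm \<Rightarrow> 'e" where
  "chart_map \<kappa> = snd \<kappa>"

definition chart_image :: "('m, 'e) chart \<Rightarrow> 'e set" where
  "chart_image \<kappa> = chart_map \<kappa> ` chart_dom \<kappa>"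

definition transition :: "('m, 'e) chart \<Rightarrow> ('m, 'e) chart \<Rightarrow> 'e \<Rightarrow> 'e" where
  "transition \<kappa> \<kappa>' = chart_map \<kappa>' \<circ> inv_into (chart_dom \<kappa>) (chart_map \<kappa>)"

definition transition_deriv ::
    "('m, 'e::euclidean_space) chart \<Rightarrow> ('m, 'e) chart \<Rightarrow> 'm \<Rightarrow> 'e \<Rightarrow> 'e" where
  "transition_deriv \<kappa> \<kappa>' x = frechet_derivative (transition \<kappa> \<kappa>') (at (chart_map \<kappa> x))"

type_synonym ('m, 'e) bilinear_field = "('m, 'e) chart \<Rightarrow> 'e \<Rightarrow> 'e \<Rightarrow> 'e \<Rightarrow> real"
type_synonym ('m, 'e) endo_field = "('m, 'e) chart \<Rightarrow> 'e \<Rightarrow> 'e \<Rightarrow> 'e"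

definition smooth_bilinear_field ::
    "('m, 'e::euclidean_space) chart set \<Rightarrow> ('m, 'e) bilinear_field \<Rightarrow> bool" where
  "smooth_bilinear_field A b \<longleftrightarrow>
     (\<forall>\<kappa>\<in>A. (\<forall>p\<in>chart_image \<kappa>. bilinear (b \<kappa> p)) \<and>
             (\<forall>v w. smooth_on (chart_image \<kappa>) (\<lambda>p. b \<kappa> p v w))) \<and>
     (\<forall>\<kappa>\<in>A. \<forall>\<kappa>'\<in>A. \<forall>x\<in>chart_dom \<kappa> \<inter> chart_dom \<kappa>'. \<forall>v w.
        b \<kappa> (chart_map \<kappa> x) v w =
        b \<kappa>' (chart_map \<kappa>' x) (transition_deriv \<kappa> \<kappa>' x v) (transition_deriv \<kappa> \<kappa>' x w))"

definition smooth_endo_field ::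
    "('m, 'e::euclidean_space) chart set \<Rightarrow> ('m, 'e) endo_field \<Rightarrow> bool" where
  "smooth_endo_field A J \<longleftrightarrow>
     (\<forall>\<kappa>\<in>A. (\<forall>p\<in>chart_image \<kappa>. linear (J \<kappa> p)) \<and>
             (\<forall>v. smooth_on (chart_image \<kappa>) (\<lambda>p. J \<kappa> p v))) \<and>
     (\<forall>\<kappa>\<in>A. \<forall>\<kappa>'\<in>A. \<forall>x\<in>chart_dom \<kappa> \<inter> chart_dom \<kappa>'. \<forall>v.
        transition_deriv \<kappa> \<kappa>' x (J \<kappa> (chart_map \<kappa> x) v) =
        J \<kappa>' (chart_map \<kappa>' x) (transition_deriv \<kappa> \<kappa>' x v))"


section \<open>Kaehler metrics\<close>

definition riemannian_metric ::
    "('m, 'e::euclidean_space) chart set \<Rightarrow> ('m, 'e) bilinear_field \<Rightarrow> bool" where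
  "riemannian_metric A g \<longleftrightarrow> smooth_bilinear_field A g \<and>
     (\<forall>\<kappa>\<in>A. \<forall>p\<in>chart_image \<kappa>.
        (\<forall>v w. g \<kappa> p v w = g \<kappa> p w v) \<and> (\<forall>v. v \<noteq> 0 \<longrightarrow> g \<kappa> p v v > 0))"

definition almost_complex_structure ::
    "('m, 'e::euclidean_space) chart set \<Rightarrow> ('m, 'e) endo_field \<Rightarrow> bool" where
  "almost_complex_structure A J \<longleftrightarrow> smooth_endo_field A J \<and>
     (\<forall>\<kappa>\<in>A. \<forall>p\<in>chart_image \<kappa>. \<forall>v. J \<kappa> p (J \<kappa> p v) = - v)"

definition nijenhuis ::
    "('e::euclidean_space \<Rightarrow> 'e \<Rightarrow> 'e) \<Rightarrow> ('e \<Rightarrow> 'e) \<Rightarrow> ('e \<Rightarrow> 'e) \<Rightarrow> 'e \<Rightarrow> 'e" where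
  "nijenhuis j X Y p =
     lie_bracket (\<lambda>q. j q (X q)) (\<lambda>q. j q (Y q)) p
     - j p (lie_bracket (\<lambda>q. j q (X q)) Y p)
     - j p (lie_bracket X (\<lambda>q. j q (Y q)) p)
     - lie_bracket X Y p"

text \<open>Integrability is the vanishing of the Nijenhuis tensor.\<close>

definition complex_structure ::
    "('m, 'e::euclidean_space) chart set \<Rightarrow> ('m, 'e) endo_field \<Rightarrow> bool" where
  "complex_structure A J \<longleftrightarrow> almost_complex_structure A J \<and>
     (\<forall>\<kappa>\<in>A. \<forall>X Y. smooth_on (chart_image \<kappa>) X \<longrightarrow> smooth_on (chart_image \<kappa>) Y \<longrightarrow>
        (\<forall>p\<in>chart_image \<kappa>. nijenhuis (J \<kappa>) X Y p = 0))"

definition hermitian_metric ::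
    "('m, 'e::euclidean_space) chart set \<Rightarrow> ('m, 'e) endo_field \<Rightarrow> ('m, 'e) bilinear_field \<Rightarrow> bool" where
  "hermitian_metric A J g \<longleftrightarrow> riemannian_metric A g \<and>
     (\<forall>\<kappa>\<in>A. \<forall>p\<in>chart_image \<kappa>. \<forall>v w. g \<kappa> p (J \<kappa> p v) (J \<kappa> p w) = g \<kappa> p v w)"

definition fundamental_form ::
    "('m, 'e) endo_field \<Rightarrow> ('m, 'e) bilinear_field \<Rightarrow> ('m, 'e) bilinear_field" where
  "fundamental_form J g \<kappa> p v w = g \<kappa> p (J \<kappa> p v) w"

text \<open>The exterior derivative of a 2-form in coordinates, evaluated on constant vector fields
  (whose brackets vanish).\<close>

definition ext_deriv2 ::
    "('e::euclidean_space \<Rightarrow> 'e \<Rightarrow> 'e \<Rightarrow> real) \<Rightarrow> 'e \<Rightarrow> 'e \<Rightarrow> 'e \<Rightarrow> 'e \<Rightarrow> real" where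
  "ext_deriv2 \<omega> p u v w =
     frechet_derivative (\<lambda>q. \<omega> q v w) (at p) u
     + frechet_derivative (\<lambda>q. \<omega> q w u) (at p) v
     + frechet_derivative (\<lambda>q. \<omega> q u v) (at p) w"

definition closed_2form ::
    "('m, 'e::euclidean_space) chart set \<Rightarrow> ('m, 'e) bilinear_field \<Rightarrow> bool" where
  "closed_2form A \<omega> \<longleftrightarrow>
     (\<forall>\<kappa>\<in>A. \<forall>p\<in>chart_image \<kappa>. \<forall>u v w. ext_deriv2 (\<omega> \<kappa>) p u v w = 0)"

definition kaehler_metric ::
    "('m, 'e::euclidean_space) chart set \<Rightarrow> ('m, 'e) endo_field \<Rightarrow> ('m, 'e) bilinear_field \<Rightarrow> bool" where
  "kaehler_metric A J g \<longleftrightarrow>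
     complex_structure A J \<and> hermitian_metric A J g \<and> closed_2form A (fundamental_form J g)"

definition admits_kaehler_metric :: "('m, 'e::euclidean_space) chart set \<Rightarrow> bool" where
  "admits_kaehler_metric A \<longleftrightarrow> (\<exists>J g. kaehler_metric A J g)"


section \<open>The solvable group, the subgroup and the quotient\<close>

type_synonym solv = "real \<times> real \<times> complex \<times> complex"

text \<open>The power of \<open>\<alpha>\<close> is taken with respect to the principal branch of the logarithm.
  The first coordinate of every element of \<open>Gamma\<close> below is an integer, so another branch gives the
  same left translations by \<open>Gamma\<close> and hence the same quotient.\<close>

fun solv_mult :: "real \<Rightarrow> complex \<Rightarrow> solv \<Rightarrow> solv \<Rightarrow> solv" where
  "solv_mult c \<alpha> (t, u, z, w) (t', u', z', w') =
     (t + t', c powr t * u' + u, \<alpha> powr of_real t * z' + z, exp (\<i> * of_real (pi / 2 * t)) * w' + w)"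

definition Solv :: "real \<Rightarrow> complex \<Rightarrow> solv monoid" where
  "Solv c \<alpha> = \<lparr>carrier = UNIV, mult = solv_mult c \<alpha>, one = (0, 0, 0, 0)\<rparr>"

definition Gamma :: "real \<Rightarrow> complex \<Rightarrow> real ^ 3 \<Rightarrow> complex ^ 3 \<Rightarrow> solv set" where
  "Gamma c \<alpha> cv av = generate (Solv c \<alpha>)
     ({(1, 0, 0, 0)} \<union> range (\<lambda>j. (0, cv $ j, av $ j, 0)) \<union> {(0, 0, 0, 1), (0, 0, 0, \<i>)})"

lemma group_Solv:
  assumes "c > 0" "\<alpha> \<noteq> 0"
  shows "group (Solv c \<alpha>)"
proof (rule groupI)
  fix x y z assume "x \<in> carrier (Solv c \<alpha>)" "y \<in> carrier (Solv c \<alpha>)" "z \<in> carrier (Solv c \<alpha>)"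
  show "x \<otimes>\<^bsub>Solv c \<alpha>\<^esub> y \<otimes>\<^bsub>Solv c \<alpha>\<^esub> z = x \<otimes>\<^bsub>Solv c \<alpha>\<^esub> (y \<otimes>\<^bsub>Solv c \<alpha>\<^esub> z)"
    by (cases x; cases y; cases z)
       (simp add: Solv_def powr_add algebra_simps add_divide_distrib exp_add)
next
  fix x assume "x \<in> carrier (Solv c \<alpha>)"
  obtain t u z w where x: "x = (t, u, z, w)" by (cases x)
  have "(- t, - (c powr (- t) * u), - (\<alpha> powr of_real (- t) * z),
         - (exp (\<i> * of_real (pi / 2 * (- t))) * w)) \<otimes>\<^bsub>Solv c \<alpha>\<^esub> x = \<one>\<^bsub>Solv c \<alpha>\<^esub>"
    by (simp add: Solv_def x)
  then show "\<exists>y\<in>carrier (Solv c \<alpha>). y \<otimes>\<^bsub>Solv c \<alpha>\<^esub> x = \<one>\<^bsub>Solv c \<alpha>\<^esub>"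
    by (auto simp: Solv_def)
qed (use assms in \<open>auto simp: Solv_def\<close>)

text \<open>The generators act by left translation as the transformations that define the subgroup.\<close>

lemma solv_mult_generators:
  assumes "c > 0" "\<alpha> \<noteq> 0"
  shows "solv_mult c \<alpha> (1, 0, 0, 0) (t, u, z, w) = (t + 1, c * u, \<alpha> * z, \<i> * w)"
    and "solv_mult c \<alpha> (0, r, a, 0) (t, u, z, w) = (t, u + r, z + a, w)"
    and "solv_mult c \<alpha> (0, 0, 0, b) (t, u, z, w) = (t, u, z, w + b)"
  using assms by (auto simp: exp_eq_polar cis_conv_exp[symmetric])

text \<open>
  The quotient consists of the orbits of the left translations by \<open>Gamma\<close>, that is, of the
  right cosets of \<open>Gamma\<close>. These translations form a free and properly discontinuous action, so
  the quotient manifold structure is given by the local sections of the projection: the image of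
  an open set on which the projection is injective is the domain of a chart, and the transition
  maps are locally left translations.
\<close>

definition M6 :: "real \<Rightarrow> complex \<Rightarrow> real ^ 3 \<Rightarrow> complex ^ 3 \<Rightarrow> solv set set" where
  "M6 c \<alpha> cv av = rcosets\<^bsub>Solv c \<alpha>\<^esub> (Gamma c \<alpha> cv av)"

definition M6_proj :: "real \<Rightarrow> complex \<Rightarrow> real ^ 3 \<Rightarrow> complex ^ 3 \<Rightarrow> solv \<Rightarrow> solv set" where
  "M6_proj c \<alpha> cv av x = Gamma c \<alpha> cv av #>\<^bsub>Solv c \<alpha>\<^esub> x"

definition M6_atlas ::
    "real \<Rightarrow> complex \<Rightarrow> real ^ 3 \<Rightarrow> complex ^ 3 \<Rightarrow> (solv set, solv) chart set" where
  "M6_atlas c \<alpha> cv av =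
     {(M6_proj c \<alpha> cv av ` V, inv_into V (M6_proj c \<alpha> cv av)) |V.
        open V \<and> inj_on (M6_proj c \<alpha> cv av) V}"

lemma M6_eq: "M6 c \<alpha> cv av = range (M6_proj c \<alpha> cv av)"
  by (auto simp: M6_def M6_proj_def RCOSETS_def Solv_def)

end

theory Submission
  imports Defs
begin

text \<open>
  The quotient is not even symplectic. Let \<open>\<omega>\<close> be a symplectic form on it, lifted to the covering space,
  where the planes \<open>t = const\<close> cover five-dimensional tori \<open>F\<^sub>t\<close>. The cohomology class of \<open>\<omega>\<close> on
  \<open>F\<^sub>t\<close> does not depend on \<open>t\<close> and is invariant under the monodromy, whose eigenvalues are \<open>c\<close>, \<open>\<alpha>\<close>,
  \<open>cnj \<alpha>\<close>, \<open>\<i>\<close>, \<open>-\<i>\<close>; hence it is represented by a multiple \<open>b\<close> of the area form of the last factor, and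
  \<open>b \<and> b = 0\<close>. Write \<open>\<omega> = b + d \<eta>\<close> on \<open>F\<^sub>t\<close> with \<open>\<partial>\<^sub>t \<eta> = \<iota>\<^sub>T \<omega>\<close>, where \<open>T = \<partial>\<^sub>t\<close>. The integral of
  \<open>\<eta> \<and> d \<eta> \<and> (b + d \<eta> / 3)\<close> over \<open>F\<^sub>t\<close> does not depend on the choice of \<open>\<eta>\<close>, so the monodromy makes it
  periodic in \<open>t\<close>. But its derivative is the integral of \<open>\<iota>\<^sub>T \<omega> \<and> \<omega> \<and> \<omega>\<close>, which never vanishes
  because \<open>\<omega>\<close> is nondegenerate. Integrals over \<open>F\<^sub>t\<close> are expressed as iterated averages along the
  generators of the lattice of periods.
\<close>

section \<open>Directional derivatives and averages along lines\<close>

text \<open>The secondary integrand is a primitive in disguise. If \<open>b\<close> and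
  \<open>\<eta>\<close> are read as forms without \<open>dt\<close> component, the lifted form is
  \<open>b + d \<eta>\<close> on the whole covering space. As \<open>b \<and> b = 0\<close>, its
  cube is \<open>3 d (\<eta> \<and> d \<eta> \<and> (b + d \<eta> / 3))\<close>, so the argument is
  Stokes' theorem for the cube on the slab between \<open>t = 0\<close> and \<open>t = 1\<close>.
  The obstacle is that this primitive does not descend to the quotient: the monodromy turns
  \<open>\<eta>\<close> into another primitive. The difference of the two is closed on the fibres
  but perhaps not exact, and integration by parts shows that it contributes nothing to the integral.
  Two bases of the fibre directions occur: \<open>fibre_basis\<close>, which puts the monodromy in
  block form, and a basis of the lattice of periods, along which averages are taken. What links them
  is their common span, which is why the lemmas on means speak of spans.\<close>

definition dir_deriv :: "('a::real_normed_vector \<Rightarrow> real) \<Rightarrow> 'a \<Rightarrow> 'a \<Rightarrow> real" where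
  "dir_deriv f v x = deriv (\<lambda>r. f (x + r *\<^sub>R v)) 0"

text \<open>Derivatives are taken along lines, so that integrals depending on a parameter are
  differentiated by the one-variable Leibniz rule. Linearity in the direction is recorded here
  because directional derivatives alone do not give it.\<close>

definition C1 :: "('a::real_normed_vector \<Rightarrow> real) \<Rightarrow> bool" where
  "C1 f \<longleftrightarrow> continuous_on UNIV f \<and> (\<forall>v. continuous_on UNIV (dir_deriv f v)) \<and> (\<forall>x. linear (\<lambda>v. dir_deriv f v x)) \<and>
     (\<forall>v x. ((\<lambda>r. f (x + r *\<^sub>R v)) has_real_derivative dir_deriv f v x) (at 0))"

lemma C1I:
  assumes "continuous_on UNIV f" "\<And>v. continuous_on UNIV (f' v)" "\<And>x. linear (\<lambda>v. f' v x)"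
    and "\<And>v x. ((\<lambda>r. f (x + r *\<^sub>R v)) has_real_derivative f' v x) (at 0)"
  shows "C1 f" and "dir_deriv f v = f' v"
proof -
  have *: "dir_deriv f v = f' v" for v
    unfolding dir_deriv_def using assms(4) DERIV_imp_deriv by blast
  show "dir_deriv f v = f' v" by (fact *)
  show "C1 f" unfolding C1_def using assms by (simp add: *)
qed

lemma C1_cont: "C1 f \<Longrightarrow> continuous_on UNIV f"
  and C1_cont_dir_deriv: "C1 f \<Longrightarrow> continuous_on UNIV (dir_deriv f v)"
  and linear_dir_deriv: "C1 f \<Longrightarrow> linear (\<lambda>v. dir_deriv f v x)"
  by (auto simp: C1_def)

lemma C1_deriv_0: "C1 f \<Longrightarrow> ((\<lambda>r. f (x + r *\<^sub>R v)) has_real_derivative dir_deriv f v x) (at 0)"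
  by (auto simp: C1_def)

lemma C1_deriv:
  assumes "C1 f"
  shows "((\<lambda>r. f (x + r *\<^sub>R v)) has_real_derivative dir_deriv f v (x + s *\<^sub>R v)) (at s within S)"
proof -
  have "((\<lambda>r. f ((x + s *\<^sub>R v) + r *\<^sub>R v)) has_real_derivative dir_deriv f v (x + s *\<^sub>R v)) (at (s - s))"
    using C1_deriv_0[OF assms] by simp
  then have "((\<lambda>r. f ((x + s *\<^sub>R v) + (r - s) *\<^sub>R v)) has_real_derivative dir_deriv f v (x + s *\<^sub>R v)) (at s)"
    using DERIV_shift[of "\<lambda>r. f ((x + s *\<^sub>R v) + r *\<^sub>R v)" _ s "-s"] by simp
  then show ?thesis
    by (simp add: algebra_simps has_field_derivative_at_within)
qed

lemma continuous_comp:
  "continuous_on UNIV f \<Longrightarrow> continuous_on S g \<Longrightarrow> continuous_on S (\<lambda>x. f (g x))"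
  by (rule continuous_on_compose2) auto

lemma C1_const: "C1 (\<lambda>x. k)" and dir_deriv_const: "dir_deriv (\<lambda>x. k) v = (\<lambda>x. 0)"
  using C1I[of "\<lambda>x. k" "\<lambda>v x. 0"] by (auto intro: linear_zero)

lemma
  assumes "C1 f" "C1 g"
  shows C1_add: "C1 (\<lambda>x. f x + g x)" and dir_deriv_add: "dir_deriv (\<lambda>x. f x + g x) v = (\<lambda>x. dir_deriv f v x + dir_deriv g v x)"
    and C1_diff: "C1 (\<lambda>x. f x - g x)" and dir_deriv_diff: "dir_deriv (\<lambda>x. f x - g x) v = (\<lambda>x. dir_deriv f v x - dir_deriv g v x)"
    and C1_mult: "C1 (\<lambda>x. f x * g x)"
    and dir_deriv_mult: "dir_deriv (\<lambda>x. f x * g x) v = (\<lambda>x. dir_deriv f v x * g x + f x * dir_deriv g v x)"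
proof -
  note c = C1_cont[OF assms(1)] C1_cont[OF assms(2)] C1_cont_dir_deriv[OF assms(1)] C1_cont_dir_deriv[OF assms(2)]
  show "C1 (\<lambda>x. f x + g x)" "dir_deriv (\<lambda>x. f x + g x) v = (\<lambda>x. dir_deriv f v x + dir_deriv g v x)"
    by (rule C1I[of "\<lambda>x. f x + g x" "\<lambda>v x. dir_deriv f v x + dir_deriv g v x"];
        intro continuous_intros c DERIV_add C1_deriv_0 linear_compose_add linear_dir_deriv assms)+
  show "C1 (\<lambda>x. f x - g x)" "dir_deriv (\<lambda>x. f x - g x) v = (\<lambda>x. dir_deriv f v x - dir_deriv g v x)"
    by (rule C1I[of "\<lambda>x. f x - g x" "\<lambda>v x. dir_deriv f v x - dir_deriv g v x"];
        intro continuous_intros c DERIV_diff C1_deriv_0 linear_compose_sub linear_dir_deriv assms)+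
  have d: "((\<lambda>r. f (x + r *\<^sub>R v) * g (x + r *\<^sub>R v)) has_real_derivative
      dir_deriv f v x * g x + f x * dir_deriv g v x) (at 0)" for v x
    using DERIV_mult[OF C1_deriv_0[OF assms(1)] C1_deriv_0[OF assms(2)], of x v x v]
    by (simp add: mult.commute)
  have l: "linear (\<lambda>v. dir_deriv f v x * g x + f x * dir_deriv g v x)" for x
    using linear_dir_deriv[OF assms(1), of x] linear_dir_deriv[OF assms(2), of x]
    by (auto simp: linear_iff algebra_simps)
  show "C1 (\<lambda>x. f x * g x)" "dir_deriv (\<lambda>x. f x * g x) v = (\<lambda>x. dir_deriv f v x * g x + f x * dir_deriv g v x)"
    by (rule C1I[of "\<lambda>x. f x * g x" "\<lambda>v x. dir_deriv f v x * g x + f x * dir_deriv g v x"];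
        intro continuous_intros c d l)+
qed

lemma
  assumes "C1 f"
  shows C1_cmult: "C1 (\<lambda>x. k * f x)" and dir_deriv_cmult: "dir_deriv (\<lambda>x. k * f x) v = (\<lambda>x. k * dir_deriv f v x)"
  using C1_mult[OF C1_const assms, of k] dir_deriv_mult[OF C1_const assms, of k v]
  by (simp_all add: dir_deriv_const)

lemma
  assumes f: "C1 f" and G: "bounded_linear G"
  shows C1_affine: "C1 (\<lambda>x. f (y + G x))"
    and dir_deriv_affine: "dir_deriv (\<lambda>x. f (y + G x)) v = (\<lambda>x. dir_deriv f (G v) (y + G x))"
proof -
  interpret G: bounded_linear G by fact
  have c: "continuous_on UNIV (\<lambda>x. h (y + G x))" if "continuous_on UNIV h" for h
    by (rule continuous_comp[OF that]) (intro continuous_intros G.continuous_on)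
  have d: "((\<lambda>r. f (y + G (x + r *\<^sub>R v))) has_real_derivative dir_deriv f (G v) (y + G x)) (at 0)" for x v
    using C1_deriv_0[OF f, of "y + G x" "G v"] by (simp add: G.add G.scaleR algebra_simps)
  have l: "linear (\<lambda>v. dir_deriv f (G v) (y + G x))" for x
    using linear_dir_deriv[OF f, of "y + G x"] by (auto simp: linear_iff G.add G.scaleR)
  note a = C1I[of "\<lambda>x. f (y + G x)" "\<lambda>v x. dir_deriv f (G v) (y + G x)"]
  show "C1 (\<lambda>x. f (y + G x))" "dir_deriv (\<lambda>x. f (y + G x)) v = (\<lambda>x. dir_deriv f (G v) (y + G x))"
    by (rule a; use c d l C1_cont[OF f] C1_cont_dir_deriv[OF f] in blast)+
qed

lemma dir_deriv_scaleR: "C1 f \<Longrightarrow> dir_deriv f (k *\<^sub>R v) x = k * dir_deriv f v x"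
  using linear_cmul[OF linear_dir_deriv] by fastforce

text \<open>On the line \<open>x + r *\<^sub>R v\<close> this is the Leibniz rule in the single
  variable \<open>r\<close>. Joint continuity in the point and the integration variable makes the
  integral and its derivatives continuous.\<close>

lemma
  fixes h :: "'a::real_normed_vector \<Rightarrow> real \<Rightarrow> real"
  assumes h: "\<And>s. C1 (\<lambda>x. h x s)"
    and c0: "continuous_on UNIV (\<lambda>(x, s). h x s)"
    and c1: "\<And>v. continuous_on UNIV (\<lambda>(x, s). dir_deriv (\<lambda>x. h x s) v x)"
  shows C1_integral: "C1 (\<lambda>x. integral {0..1} (h x))"
    and dir_deriv_integral: "dir_deriv (\<lambda>x. integral {0..1} (h x)) v = (\<lambda>x. integral {0..1} (\<lambda>s. dir_deriv (\<lambda>x. h x s) v x))"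
proof -
  have ci: "continuous_on UNIV (\<lambda>x. integral {0..1} (k x))"
    if "continuous_on UNIV (\<lambda>(x, s). k x s)" for k :: "'a \<Rightarrow> real \<Rightarrow> real"
    using integral_continuous_on_param[of UNIV "0::real" 1 k] continuous_on_subset[OF that]
    by simp
  have i: "(\<lambda>s. dir_deriv (\<lambda>x. h x s) v x) integrable_on {0..1}" for v x
  proof (rule integrable_continuous_real)
    have "continuous_on {0..1} (\<lambda>s::real. (x, s))" by (intro continuous_intros)
    from continuous_comp[OF c1[of v] this]
    show "continuous_on {0..1} (\<lambda>s. dir_deriv (\<lambda>x. h x s) v x)" by simp
  qed
  have l: "linear (\<lambda>v. integral {0..1} (\<lambda>s. dir_deriv (\<lambda>x. h x s) v x))" for x
    using linear_dir_deriv[OF h, where x = x] by (auto simp: linear_iff integral_add i)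
  have d: "((\<lambda>r. integral {0..1} (h (x + r *\<^sub>R v))) has_real_derivative
        integral {0..1} (\<lambda>s. dir_deriv (\<lambda>x. h x s) v x)) (at 0)" for x v
  proof -
    have "((\<lambda>r. integral (cbox 0 1) (h (x + r *\<^sub>R v))) has_real_derivative
        integral (cbox 0 1) (\<lambda>s. dir_deriv (\<lambda>x. h x s) v (x + 0 *\<^sub>R v))) (at 0 within UNIV)"
    proof (rule leibniz_rule_field_derivative[where f = "\<lambda>r s. h (x + r *\<^sub>R v) s" and
          fx = "\<lambda>r s. dir_deriv (\<lambda>x. h x s) v (x + r *\<^sub>R v)" and U = UNIV])
      show "((\<lambda>r. h (x + r *\<^sub>R v) s) has_real_derivative dir_deriv (\<lambda>x. h x s) v (x + r *\<^sub>R v)) (at r within UNIV)" for r s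
        using C1_deriv[OF h] by simp
      have "continuous_on (cbox 0 1) (h (x + r *\<^sub>R v))" for r
        using continuous_comp[OF c0, of "cbox 0 1" "\<lambda>s. (x + r *\<^sub>R v, s)"]
        by (simp add: continuous_on_Pair)
      then show "h (x + r *\<^sub>R v) integrable_on cbox 0 1" for r
        by (rule integrable_continuous)
      show "continuous_on (UNIV \<times> cbox 0 1) (\<lambda>(r, s). dir_deriv (\<lambda>x. h x s) v (x + r *\<^sub>R v))"
        using continuous_comp[OF c1[of v], of "UNIV \<times> cbox 0 1" "\<lambda>p. (x + fst p *\<^sub>R v, snd p)"]
        by (simp add: continuous_on_Pair continuous_on_add continuous_on_scaleR continuous_on_fst
            continuous_on_snd continuous_on_id continuous_on_const case_prod_beta)
    qed auto
    then show ?thesis by simp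
  qed
  note a = C1I[of "\<lambda>x. integral {0..1} (h x)" "\<lambda>v x. integral {0..1} (\<lambda>s. dir_deriv (\<lambda>x. h x s) v x)"]
  show "C1 (\<lambda>x. integral {0..1} (h x))"
    "dir_deriv (\<lambda>x. integral {0..1} (h x)) v = (\<lambda>x. integral {0..1} (\<lambda>s. dir_deriv (\<lambda>x. h x s) v x))"
    by (rule a; use ci c0 c1 l d in blast)+
qed

text \<open>Two weights occur: the constant 1 gives the averaging projection, and \<open>s\<close>
  gives the homotopy operator that produces primitives.\<close>

definition line_avg :: "(real \<Rightarrow> real) \<Rightarrow> 'a::real_normed_vector \<Rightarrow> ('a \<Rightarrow> real) \<Rightarrow> 'a \<Rightarrow> real" where
  "line_avg \<phi> V f x = integral {0..1} (\<lambda>s. \<phi> s * f (x + s *\<^sub>R V))"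

lemma continuous_line:
  fixes f :: "'a::real_normed_vector \<Rightarrow> real"
  assumes "continuous_on UNIV f" "continuous_on UNIV \<phi>"
  shows "continuous_on UNIV (\<lambda>(x, s). \<phi> s * f (x + s *\<^sub>R V))"
  unfolding case_prod_beta
  by (rule continuous_on_mult[OF continuous_comp[OF assms(2)] continuous_comp[OF assms(1)]])
    (intro continuous_intros)+

lemma
  assumes "C1 f" "continuous_on UNIV \<phi>"
  shows C1_line_avg: "C1 (line_avg \<phi> V f)"
    and dir_deriv_line_avg: "dir_deriv (line_avg \<phi> V f) v = line_avg \<phi> V (dir_deriv f v)"
proof -
  have h: "C1 (\<lambda>x. \<phi> s * f (x + s *\<^sub>R V))" 
    "dir_deriv (\<lambda>x. \<phi> s * f (x + s *\<^sub>R V)) v = (\<lambda>x. \<phi> s * dir_deriv f v (x + s *\<^sub>R V))" for s v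
    using C1_cmult[OF C1_affine[OF assms(1) bounded_linear_ident, of "s *\<^sub>R V"], of "\<phi> s"]
      dir_deriv_cmult[OF C1_affine[OF assms(1) bounded_linear_ident, of "s *\<^sub>R V"], of "\<phi> s" v]
      dir_deriv_affine[OF assms(1) bounded_linear_ident, of "s *\<^sub>R V" v]
    by (simp_all add: add.commute)
  note c = continuous_line[OF C1_cont[OF assms(1)] assms(2), of V]
    continuous_line[OF C1_cont_dir_deriv[OF assms(1)] assms(2), of _ V]
  show "C1 (line_avg \<phi> V f)" "dir_deriv (line_avg \<phi> V f) v = line_avg \<phi> V (dir_deriv f v)"
    using C1_integral[of "\<lambda>x s. \<phi> s * f (x + s *\<^sub>R V)"] dir_deriv_integral[of "\<lambda>x s. \<phi> s * f (x + s *\<^sub>R V)" v] h c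
    unfolding line_avg_def[abs_def] by simp_all
qed

lemma continuous_on_line_avg:
  assumes "continuous_on UNIV f" "continuous_on UNIV \<phi>"
  shows "continuous_on UNIV (line_avg \<phi> V f)"
  using integral_continuous_on_param[of UNIV "0::real" 1 "\<lambda>x s. \<phi> s * f (x + s *\<^sub>R V)"]
    continuous_on_subset[OF continuous_line[OF assms]]
  by (simp add: line_avg_def[abs_def])

lemma line_avg_integrable:
  fixes f :: "'a::real_normed_vector \<Rightarrow> real" and \<phi> :: "real \<Rightarrow> real"
  assumes "continuous_on UNIV f" "continuous_on UNIV \<phi>"
  shows "(\<lambda>s. \<phi> s * f (x + s *\<^sub>R V)) integrable_on {0..1}"
proof -
  have "continuous_on {0..1} (\<lambda>s. \<phi> s * f (x + s *\<^sub>R V))"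
    by (rule continuous_on_mult[OF continuous_on_subset[OF assms(2)] continuous_comp[OF assms(1)]])
      (simp, intro continuous_intros)
  then show ?thesis by (rule integrable_continuous_real)
qed

lemma line_avg_add:
  assumes "continuous_on UNIV f" "continuous_on UNIV g" "continuous_on UNIV \<phi>"
  shows "line_avg \<phi> V (\<lambda>x. f x + g x) x = line_avg \<phi> V f x + line_avg \<phi> V g x"
  unfolding line_avg_def distrib_left
  by (intro integral_add line_avg_integrable assms)

lemma line_avg_cmult: "line_avg \<phi> V (\<lambda>x. k * f x) x = k * line_avg \<phi> V f x"
  unfolding line_avg_def by (simp add: mult.left_commute)

lemma line_avg_shift:
  assumes "\<And>x. f (x + y) = f x"
  shows "line_avg \<phi> V f (x + y) = line_avg \<phi> V f x"
proof -
  have "f (x + y + s *\<^sub>R V) = f (x + s *\<^sub>R V)" for s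
    using assms[of "x + s *\<^sub>R V"] by (simp add: algebra_simps)
  then show ?thesis by (simp add: line_avg_def)
qed

lemma line_avg_affine:
  assumes "bounded_linear G"
  shows "line_avg \<phi> V (\<lambda>x. f (y + G x)) x = line_avg \<phi> (G V) f (y + G x)"
proof -
  interpret G: bounded_linear G by fact
  show ?thesis unfolding line_avg_def by (simp add: G.add G.scaleR algebra_simps)
qed

abbreviation "period_avg \<equiv> line_avg (\<lambda>s. 1)"

lemma period_avg_swap:
  assumes "continuous_on UNIV (f :: 'a::real_normed_vector \<Rightarrow> real)"
  shows "period_avg V (period_avg W f) x = period_avg W (period_avg V f) x"
proof -
  have "continuous_on UNIV (\<lambda>(s, r). f (x + s *\<^sub>R V + r *\<^sub>R W))"
    unfolding case_prod_beta
    by (rule continuous_comp[OF assms]) (intro continuous_intros)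
  then have "continuous_on (cbox (0, 0) (1, 1)) (\<lambda>(s::real, r::real). f (x + s *\<^sub>R V + r *\<^sub>R W))"
    using continuous_on_subset by blast
  then have "integral (cbox (0::real) 1) (\<lambda>s. integral (cbox (0::real) 1) (\<lambda>r. f (x + s *\<^sub>R V + r *\<^sub>R W)))
      = integral (cbox 0 1) (\<lambda>r. integral (cbox 0 1) (\<lambda>s. f (x + s *\<^sub>R V + r *\<^sub>R W)))"
    by (rule integral_swap_continuous)
  moreover have "period_avg W (period_avg V f) x =
      integral (cbox 0 1) (\<lambda>r. integral (cbox 0 1) (\<lambda>s. f (x + s *\<^sub>R V + r *\<^sub>R W)))"
    unfolding line_avg_def by (auto simp: add.assoc add.commute[of "_ *\<^sub>R V"] intro!: integral_cong)
  ultimately show ?thesis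
    by (simp add: line_avg_def)
qed

lemma period_avg_dir_deriv_eq:
  assumes "C1 f"
  shows "period_avg V (dir_deriv f V) x = f (x + V) - f x"
proof -
  have "((\<lambda>s. dir_deriv f V (x + s *\<^sub>R V)) has_integral f (x + 1 *\<^sub>R V) - f (x + 0 *\<^sub>R V)) {0..1}"
    by (rule fundamental_theorem_of_calculus)
      (auto intro!: C1_deriv[OF assms] simp: has_real_derivative_iff_has_vector_derivative[symmetric])
  then show ?thesis by (simp add: line_avg_def integral_unique)
qed

text \<open>Integration by parts for \<open>s * f (x + s *\<^sub>R V)\<close>: the boundary term at
  \<open>s = 1\<close> is \<open>f (x + V)\<close>, which periodicity turns into
  \<open>f x\<close>.\<close>

lemma weighted_avg_dir_deriv_eq:
  assumes "C1 f" "\<And>x. f (x + V) = f x"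
  shows "line_avg (\<lambda>s. s) V (dir_deriv f V) x = f x - period_avg V f x"
proof -
  have "((\<lambda>s. s * dir_deriv f V (x + s *\<^sub>R V) + f (x + s *\<^sub>R V))
      has_integral 1 * f (x + 1 *\<^sub>R V) - 0 * f (x + 0 *\<^sub>R V)) {0..1}"
    by (rule fundamental_theorem_of_calculus)
      (auto intro!: derivative_eq_intros C1_deriv[OF assms(1)] 
        simp: has_real_derivative_iff_has_vector_derivative[symmetric])
  moreover have "(\<lambda>s. s * dir_deriv f V (x + s *\<^sub>R V)) integrable_on {0..1}"
    using line_avg_integrable[OF C1_cont_dir_deriv[OF assms(1)] continuous_on_id] by simp
  moreover have "(\<lambda>s. f (x + s *\<^sub>R V)) integrable_on {0..1}"
    using line_avg_integrable[OF C1_cont[OF assms(1)] continuous_on_const[of _ 1]] by simp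
  ultimately have "f x = integral {0..1} (\<lambda>s. s * dir_deriv f V (x + s *\<^sub>R V)) + integral {0..1} (\<lambda>s. f (x + s *\<^sub>R V))"
    using assms(2) by (auto dest: integral_unique simp: integral_add)
  then show ?thesis by (simp add: line_avg_def)
qed

text \<open>The derivative of the average along \<open>V\<close> is
  \<open>f (x + V) - f x = 0\<close>, so invariance under the single period becomes invariance along
  the whole line.\<close>

lemma period_avg_invariant:
  assumes f: "C1 f" and per: "\<And>x. f (x + V) = f x"
  shows "period_avg V f (x + r *\<^sub>R V) = period_avg V f x"
proof -
  have C1: "C1 (period_avg V f)" and dir_deriv: "dir_deriv (period_avg V f) V = (\<lambda>x. 0)"
    using C1_line_avg[OF f] dir_deriv_line_avg[OF f, of _ V V] period_avg_dir_deriv_eq[OF f] per by auto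
  have "\<forall>r. ((\<lambda>r. period_avg V f (x + r *\<^sub>R V)) has_real_derivative 0) (at r)"
    using C1_deriv[OF C1, of x V] dir_deriv by simp
  then show ?thesis
    using DERIV_isconst_all[of "\<lambda>r. period_avg V f (x + r *\<^sub>R V)" r 0] by simp
qed

lemma period_avg_const: "period_avg V (\<lambda>x. k) x = k"
  by (simp add: line_avg_def)

lemma period_avg_pos:
  assumes f: "continuous_on UNIV f" and pos: "\<And>x. f x > 0"
  shows "period_avg V f x > 0"
proof -
  have c: "continuous_on {0..1} (\<lambda>s. f (x + s *\<^sub>R V))"
    by (rule continuous_comp[OF f]) (intro continuous_intros)
  have "\<exists>s\<in>{0..1}. \<forall>t\<in>{0..1}. f (x + s *\<^sub>R V) \<le> f (x + t *\<^sub>R V)"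
    by (rule continuous_attains_inf[OF _ _ c]) auto
  then obtain s where s: "\<And>t. t \<in> {0..1} \<Longrightarrow> f (x + s *\<^sub>R V) \<le> f (x + t *\<^sub>R V)"
    by blast
  have "integral {0..1::real} (\<lambda>t. f (x + s *\<^sub>R V)) \<le> integral {0..1} (\<lambda>t. f (x + t *\<^sub>R V))"
    by (rule integral_le) (auto intro: s integrable_continuous_real[OF c])
  then show ?thesis using pos[of "x + s *\<^sub>R V"] by (simp add: line_avg_def)
qed

section \<open>Iterated averages as means over a torus, and Stokes' theorem for them\<close>

primrec torus_mean :: "'a::real_normed_vector list \<Rightarrow> ('a \<Rightarrow> real) \<Rightarrow> 'a \<Rightarrow> real" where
  "torus_mean [] f = f"
| "torus_mean (V # Vs) f = period_avg V (torus_mean Vs f)"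

lemma C1_torus_mean: "C1 f \<Longrightarrow> C1 (torus_mean Vs f)"
  by (induction Vs) (auto intro: C1_line_avg)

lemma dir_deriv_torus_mean: "C1 f \<Longrightarrow> dir_deriv (torus_mean Vs f) v = torus_mean Vs (dir_deriv f v)"
  by (induction Vs) (auto simp: dir_deriv_line_avg C1_torus_mean)

lemma continuous_torus_mean: "continuous_on UNIV f \<Longrightarrow> continuous_on UNIV (torus_mean Vs f)"
  by (induction Vs) (auto intro: continuous_on_line_avg)

lemma torus_mean_add:
  "continuous_on UNIV f \<Longrightarrow> continuous_on UNIV g \<Longrightarrow>
    torus_mean Vs (\<lambda>x. f x + g x) = (\<lambda>x. torus_mean Vs f x + torus_mean Vs g x)"
  by (induction Vs) (auto simp: line_avg_add continuous_torus_mean)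

lemma torus_mean_cmult: "torus_mean Vs (\<lambda>x. k * f x) = (\<lambda>x. k * torus_mean Vs f x)"
  by (induction Vs) (auto simp: line_avg_cmult)

lemma torus_mean_diff:
  assumes "continuous_on UNIV f" "continuous_on UNIV g"
  shows "torus_mean Vs (\<lambda>x. f x - g x) = (\<lambda>x. torus_mean Vs f x - torus_mean Vs g x)"
  using torus_mean_add[of f "\<lambda>x. -1 * g x" Vs] assms
  by (simp add: torus_mean_cmult[of Vs "-1" g, simplified] continuous_on_minus)

lemma torus_mean_const: "torus_mean Vs (\<lambda>x. k) = (\<lambda>x. k)"
  by (induction Vs) (auto simp: period_avg_const)

lemma torus_mean_shift: "(\<And>x. f (x + y) = f x) \<Longrightarrow> torus_mean Vs f (x + y) = torus_mean Vs f x"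
  by (induction Vs arbitrary: x) (auto intro: line_avg_shift)

lemma torus_mean_affine:
  "bounded_linear G \<Longrightarrow> torus_mean Vs (\<lambda>x. f (y + G x)) = (\<lambda>x. torus_mean (map G Vs) f (y + G x))"
  by (induction Vs) (auto simp: line_avg_affine)

lemma period_avg_torus_mean: "continuous_on UNIV f \<Longrightarrow> period_avg V (torus_mean Vs f) = torus_mean Vs (period_avg V f)"
proof (induction Vs)
  case (Cons W Vs)
  have "period_avg V (period_avg W (torus_mean Vs f)) = period_avg W (period_avg V (torus_mean Vs f))"
    using period_avg_swap[OF continuous_torus_mean[OF Cons.prems]] by blast
  then show ?case using Cons by simp
qed simp

lemma torus_mean_swap: "continuous_on UNIV f \<Longrightarrow> torus_mean Vs (torus_mean Ws f) = torus_mean Ws (torus_mean Vs f)"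
  by (induction Vs) (auto simp: period_avg_torus_mean continuous_torus_mean)

lemma torus_mean_pos: "continuous_on UNIV f \<Longrightarrow> (\<And>x. f x > 0) \<Longrightarrow> torus_mean Vs f x > 0"
  by (induction Vs arbitrary: x) (auto intro: period_avg_pos continuous_torus_mean)

text \<open>The average along \<open>V\<close> creates invariance along the line of
  \<open>V\<close>, and the averages applied after it preserve this. Invariance along each listed
  vector then extends to the span.\<close>

lemma torus_mean_invariant:
  assumes f: "C1 f" and per: "\<And>V x. V \<in> set Vs \<Longrightarrow> f (x + V) = f x" and y: "y \<in> span (set Vs)"
  shows "torus_mean Vs f (x + y) = torus_mean Vs f x"
proof -
  have *: "torus_mean Vs f (x + r *\<^sub>R V) = torus_mean Vs f x" if "V \<in> set Vs" for V r x
    using that per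
  proof (induction Vs arbitrary: x)
    case (Cons W Ws)
    show ?case
    proof (cases "V = W")
      case True
      have "torus_mean Ws f (x + W) = torus_mean Ws f x" for x
        by (rule torus_mean_shift) (use Cons.prems in auto)
      then show ?thesis using period_avg_invariant[OF C1_torus_mean[OF f]] True by simp
    next
      case False
      then have "torus_mean Ws f (x + r *\<^sub>R V) = torus_mean Ws f x" for x
        using Cons by auto
      then show ?thesis by (simp add: line_avg_shift)
    qed
  qed simp
  show ?thesis
    using y
    by (induction arbitrary: x rule: span_induct_alt) (auto simp: * simp flip: add.assoc)
qed

lemma torus_mean_id:
  assumes "\<And>x y. y \<in> span (set Vs) \<Longrightarrow> h (x + y) = h x"
  shows "torus_mean Vs h = h"
  using assms
proof (induction Vs)
  case (Cons V Vs)
  have "torus_mean Vs h = h"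
    by (rule Cons) (use Cons.prems span_mono[of "set Vs" "set (V # Vs)"] in auto)
  moreover have "h (x + s *\<^sub>R V) = h x" for x s
    by (rule Cons.prems) (auto intro: span_scale span_base)
  ultimately show ?case by (auto simp: line_avg_def)
qed simp

text \<open>Fubini: the mean over one basis of the mean over the other is each of the two.\<close>

lemma torus_mean_basis:
  assumes f: "C1 f" and per: "\<And>V x. V \<in> set Vs \<union> set Ws \<Longrightarrow> f (x + V) = f x"
    and span: "span (set Vs) = span (set Ws)"
  shows "torus_mean Vs f = torus_mean Ws f"
proof -
  have "torus_mean Vs f (x + y) = torus_mean Vs f x" "torus_mean Ws f (x + y) = torus_mean Ws f x"
    if "y \<in> span (set Vs)" for x y
    using torus_mean_invariant[OF f, of _ y x] that span per by auto
  then have "torus_mean Vs (torus_mean Ws f) = torus_mean Ws f" "torus_mean Ws (torus_mean Vs f) = torus_mean Vs f"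
    using torus_mean_id[of Vs "torus_mean Ws f"] torus_mean_id[of Ws "torus_mean Vs f"] span by auto
  then show ?thesis using torus_mean_swap[OF C1_cont[OF f], of Vs Ws] by simp
qed

text \<open>This is the form in which Stokes' theorem on the torus is used: the mean is constant
  along \<open>v\<close>, and its derivative along \<open>v\<close> is the mean of the
  derivative.\<close>

lemma torus_mean_dir_deriv_zero:
  assumes f: "C1 f" and per: "\<And>V x. V \<in> set Vs \<Longrightarrow> f (x + V) = f x" and v: "v \<in> span (set Vs)"
  shows "torus_mean Vs (dir_deriv f v) x = 0"
proof -
  have "((\<lambda>r. torus_mean Vs f (x + r *\<^sub>R v)) has_real_derivative torus_mean Vs (dir_deriv f v) x) (at 0)"
    using C1_deriv_0[OF C1_torus_mean[OF f], of Vs x v] dir_deriv_torus_mean[OF f, of Vs v] by simp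
  moreover have "torus_mean Vs f (x + r *\<^sub>R v) = torus_mean Vs f x" for r
    by (rule torus_mean_invariant[OF f per]) (auto intro: span_scale v)
  ultimately show ?thesis
    using DERIV_unique[OF _ DERIV_const] by simp
qed

section \<open>Exterior derivatives of one-forms and primitives of closed two-forms\<close>

definition ext_deriv1 :: "('a::real_normed_vector \<Rightarrow> 'a \<Rightarrow> real) \<Rightarrow> 'a \<Rightarrow> 'a \<Rightarrow> 'a \<Rightarrow> real" where
  "ext_deriv1 \<eta> v w x = dir_deriv (\<eta> w) v x - dir_deriv (\<eta> v) w x"

lemma line_avg_linear:
  assumes "\<And>v. continuous_on UNIV (\<eta> v)" "\<And>x. linear (\<lambda>v. \<eta> v x)" "continuous_on UNIV \<phi>"
  shows "linear (\<lambda>v. line_avg \<phi> V (\<eta> v) x)"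
proof
  fix v w and k :: real
  have "\<eta> (v + w) = (\<lambda>x. \<eta> v x + \<eta> w x)"
    using linear_add[OF assms(2)] by blast
  then show "line_avg \<phi> V (\<eta> (v + w)) x = line_avg \<phi> V (\<eta> v) x + line_avg \<phi> V (\<eta> w) x"
    by (simp add: line_avg_add assms)
  have "\<eta> (k *\<^sub>R v) = (\<lambda>x. k * \<eta> v x)"
    using linear_cmul[OF assms(2)] by auto
  then show "line_avg \<phi> V (\<eta> (k *\<^sub>R v)) x = k *\<^sub>R line_avg \<phi> V (\<eta> v) x"
    by (simp add: line_avg_cmult)
qed

lemma torus_mean_linear:
  assumes "\<And>v. continuous_on UNIV (\<eta> v)" "\<And>x. linear (\<lambda>v. \<eta> v x)"
  shows "linear (\<lambda>v. torus_mean Vs (\<eta> v) x)"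
  using assms by (induction Vs arbitrary: x) (auto intro!: line_avg_linear continuous_torus_mean)

text \<open>Cartan's formula gives \<open>\<omega> - P\<^sub>V \<omega> = d (\<iota>\<^sub>V K\<^sub>V \<omega>)\<close>, where \<open>P\<^sub>V\<close> averages along \<open>V\<close> and \<open>K\<^sub>V\<close> does so
  with weight \<open>s\<close>.\<close>

lemma primitive_minus_torus_mean:
  fixes \<omega> :: "'a::real_normed_vector \<Rightarrow> 'a \<Rightarrow> 'a \<Rightarrow> real"
  assumes C1: "\<And>v w. C1 (\<omega> v w)" and lin: "\<And>v x. linear (\<lambda>w. \<omega> v w x)"
    and anti: "\<And>v w x. \<omega> v w x = - \<omega> w v x"
    and closed: "\<And>u v w x. dir_deriv (\<omega> v w) u x + dir_deriv (\<omega> w u) v x + dir_deriv (\<omega> u v) w x = 0"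
    and per: "\<And>V v w x. V \<in> L \<Longrightarrow> \<omega> v w (x + V) = \<omega> v w x"
    and Vs: "set Vs \<subseteq> L"
  shows "\<exists>\<eta>. (\<forall>v. C1 (\<eta> v)) \<and> (\<forall>x. linear (\<lambda>v. \<eta> v x)) \<and> (\<forall>V\<in>L. \<forall>v x. \<eta> v (x + V) = \<eta> v x) \<and>
    (\<forall>v w x. ext_deriv1 \<eta> v w x = \<omega> v w x - torus_mean Vs (\<omega> v w) x)"
  using Vs
proof (induction Vs)
  case Nil
  show ?case
    by (intro exI[of _ "\<lambda>v x. 0"]) (auto simp: C1_const ext_deriv1_def dir_deriv_const intro: linear_zero)
next
  \<comment> \<open>The sum telescopes: \<open>\<zeta>\<close> below is a primitive of the
    difference between the means over \<open>Vs\<close> and over \<open>V # Vs\<close>. Periodicity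
    is carried for all of \<open>L\<close>, since the primitive must later be periodic along vectors
    over which no average is taken.\<close>
  case (Cons V Vs)
  then have "set Vs \<subseteq> L" by simp
  from Cons.IH[OF this] obtain \<eta> where \<eta>: "\<And>v. C1 (\<eta> v)" "\<And>x. linear (\<lambda>v. \<eta> v x)"
    "\<And>V v x. V \<in> L \<Longrightarrow> \<eta> v (x + V) = \<eta> v x"
    "\<And>v w x. ext_deriv1 \<eta> v w x = \<omega> v w x - torus_mean Vs (\<omega> v w) x" by metis
  define \<mu> where "\<mu> v w = torus_mean Vs (\<omega> v w)" for v w
  define \<zeta> where "\<zeta> v = line_avg (\<lambda>s. s) V (\<mu> V v)" for v
  have \<mu>: "C1 (\<mu> v w)" for v w
    unfolding \<mu>_def by (intro C1_torus_mean C1)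
  have \<mu>lin: "linear (\<lambda>w. \<mu> v w x)" for v x
    unfolding \<mu>_def by (intro torus_mean_linear C1_cont C1 lin)
  have \<mu>per: "\<mu> v w (x + U) = \<mu> v w x" if "U \<in> L" for U v w x
    unfolding \<mu>_def using per that by (intro torus_mean_shift) auto
  have \<mu>closed: "dir_deriv (\<mu> V w) v x - dir_deriv (\<mu> V v) w x = dir_deriv (\<mu> v w) V x" for v w x
  proof -
    have "torus_mean Vs (\<lambda>x. dir_deriv (\<omega> V w) v x - dir_deriv (\<omega> V v) w x) = torus_mean Vs (dir_deriv (\<omega> v w) V)"
    proof (rule arg_cong[where f = "torus_mean Vs"], rule ext)
      fix x
      have "\<omega> w V = (\<lambda>x. (-1) * \<omega> V w x)"
        by (rule ext) (use anti[of w V] in simp)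
      then have "dir_deriv (\<omega> w V) v x = - dir_deriv (\<omega> V w) v x"
        using dir_deriv_cmult[OF C1, of "-1" V w v] by simp
      then show "dir_deriv (\<omega> V w) v x - dir_deriv (\<omega> V v) w x = dir_deriv (\<omega> v w) V x"
        using closed[of v w V x] by simp
    qed
    then show ?thesis
      unfolding \<mu>_def by (simp add: dir_deriv_torus_mean C1 torus_mean_diff C1_cont_dir_deriv fun_eq_iff)
  qed
  have \<zeta>: "C1 (\<zeta> v)" "dir_deriv (\<zeta> v) w = line_avg (\<lambda>s. s) V (dir_deriv (\<mu> V v) w)" for v w
    unfolding \<zeta>_def by (intro C1_line_avg dir_deriv_line_avg \<mu> continuous_on_id)+
  have \<zeta>lin: "linear (\<lambda>v. \<zeta> v x)" for x
    unfolding \<zeta>_def by (intro line_avg_linear C1_cont \<mu> \<mu>lin continuous_on_id)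
  have \<zeta>per: "\<zeta> v (x + U) = \<zeta> v x" if "U \<in> L" for U v x
    unfolding \<zeta>_def using \<mu>per that by (intro line_avg_shift) auto
  have d\<zeta>: "ext_deriv1 \<zeta> v w x = \<mu> v w x - period_avg V (\<mu> v w) x" for v w x
  proof -
    have "dir_deriv (\<mu> V w) v = (\<lambda>x. dir_deriv (\<mu> v w) V x + dir_deriv (\<mu> V v) w x)"
    proof
      fix x show "dir_deriv (\<mu> V w) v x = dir_deriv (\<mu> v w) V x + dir_deriv (\<mu> V v) w x"
        using \<mu>closed[of w v x] by linarith
    qed
    then have "ext_deriv1 \<zeta> v w x = line_avg (\<lambda>s. s) V (dir_deriv (\<mu> v w) V) x"
      unfolding ext_deriv1_def \<zeta> by (simp add: line_avg_add C1_cont_dir_deriv \<mu>)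
    also have "\<dots> = \<mu> v w x - period_avg V (\<mu> v w) x"
      by (rule weighted_avg_dir_deriv_eq[OF \<mu>]) (use \<mu>per Cons.prems in auto)
    finally show ?thesis .
  qed
  show ?case
  proof (intro exI[of _ "\<lambda>v x. \<eta> v x + \<zeta> v x"] conjI allI ballI)
    fix v w x
    show "ext_deriv1 (\<lambda>v x. \<eta> v x + \<zeta> v x) v w x = \<omega> v w x - torus_mean (V # Vs) (\<omega> v w) x"
      using \<eta>(4)[of v w x] d\<zeta>[of v w x]
      by (simp add: ext_deriv1_def dir_deriv_add \<eta> \<zeta> \<mu>_def[symmetric])
  qed (auto simp: \<eta> \<zeta> C1_add \<zeta>per intro: linear_compose_add \<eta> \<zeta>lin)
qed

section \<open>Top-degree forms on a five-dimensional space\<close>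

text \<open>The digits are the degrees of the factors of a wedge product; the remaining arguments are the vectors
  on which it is evaluated.\<close>

definition wedge22 :: "('a \<Rightarrow> 'a \<Rightarrow> real) \<Rightarrow> ('a \<Rightarrow> 'a \<Rightarrow> real) \<Rightarrow> 'a \<Rightarrow> 'a \<Rightarrow> 'a \<Rightarrow> 'a \<Rightarrow> real" where
  "wedge22 B C x y z w = B x y * C z w - B x z * C y w + B x w * C y z
     + B y z * C x w - B y w * C x z + B z w * C x y"

definition wedge112 :: "('a \<Rightarrow> real) \<Rightarrow> ('a \<Rightarrow> real) \<Rightarrow> ('a \<Rightarrow> 'a \<Rightarrow> real) \<Rightarrow> 'a \<Rightarrow> 'a \<Rightarrow> 'a \<Rightarrow> 'a \<Rightarrow> real" where
  "wedge112 a b = wedge22 (\<lambda>v w. a v * b w - a w * b v)"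

definition wedge122 :: "(nat \<Rightarrow> 'a) \<Rightarrow> ('a \<Rightarrow> real) \<Rightarrow> ('a \<Rightarrow> 'a \<Rightarrow> real) \<Rightarrow> ('a \<Rightarrow> 'a \<Rightarrow> real) \<Rightarrow> real" where
  "wedge122 e a B C =
     a (e 1) * wedge22 B C (e 2) (e 3) (e 4) (e 5) - a (e 2) * wedge22 B C (e 1) (e 3) (e 4) (e 5)
     + a (e 3) * wedge22 B C (e 1) (e 2) (e 4) (e 5) - a (e 4) * wedge22 B C (e 1) (e 2) (e 3) (e 5)
     + a (e 5) * wedge22 B C (e 1) (e 2) (e 3) (e 4)"

lemma continuous_wedge122:
  assumes "\<And>v. continuous_on UNIV (a v)" "\<And>v w. continuous_on UNIV (B v w)" "\<And>v w. continuous_on UNIV (C v w)"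
  shows "continuous_on UNIV (\<lambda>x. wedge122 e (\<lambda>v. a v x) (\<lambda>v w. B v w x) (\<lambda>v w. C v w x))"
  unfolding wedge122_def wedge22_def by (intro continuous_intros assms)

lemma
  assumes a: "\<And>v. C1 (a v)" and B: "\<And>v w. C1 (B v w)" and C: "\<And>v w. C1 (C v w)"
  shows C1_wedge122: "C1 (\<lambda>x. wedge122 e (\<lambda>v. a v x) (\<lambda>v w. B v w x) (\<lambda>v w. C v w x))" (is ?th1)
    and dir_deriv_wedge122: "dir_deriv (\<lambda>x. wedge122 e (\<lambda>v. a v x) (\<lambda>v w. B v w x) (\<lambda>v w. C v w x)) u =
      (\<lambda>x. wedge122 e (\<lambda>v. dir_deriv (a v) u x) (\<lambda>v w. B v w x) (\<lambda>v w. C v w x) +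
        wedge122 e (\<lambda>v. a v x) (\<lambda>v w. dir_deriv (B v w) u x) (\<lambda>v w. C v w x) +
        wedge122 e (\<lambda>v. a v x) (\<lambda>v w. B v w x) (\<lambda>v w. dir_deriv (C v w) u x))" (is ?th2)
proof -
  show ?th1
    unfolding wedge122_def wedge22_def by (intro C1_add C1_diff C1_mult assms)
  show ?th2
    unfolding wedge122_def wedge22_def
    by (simp add: dir_deriv_add dir_deriv_diff dir_deriv_mult C1_add C1_diff C1_mult assms) (simp add: fun_eq_iff algebra_simps)
qed

lemma dir_deriv_wedge112:
  assumes a: "\<And>v. C1 (a v)" and b: "\<And>v. C1 (b v)" and C: "\<And>v w. C1 (C v w)"
  shows "dir_deriv (\<lambda>x. wedge112 (\<lambda>v. a v x) (\<lambda>v. b v x) (\<lambda>v w. C v w x) y z v w) u =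
      (\<lambda>x. wedge112 (\<lambda>v. dir_deriv (a v) u x) (\<lambda>v. b v x) (\<lambda>v w. C v w x) y z v w +
        wedge112 (\<lambda>v. a v x) (\<lambda>v. dir_deriv (b v) u x) (\<lambda>v w. C v w x) y z v w +
        wedge112 (\<lambda>v. a v x) (\<lambda>v. b v x) (\<lambda>v w. dir_deriv (C v w) u x) y z v w)"
  unfolding wedge112_def wedge22_def
  by (simp add: dir_deriv_add dir_deriv_diff dir_deriv_mult C1_add C1_diff C1_mult assms) (simp add: fun_eq_iff algebra_simps)

text \<open>If \<open>F u\<close> is the derivative along \<open>u\<close> of a four-form, this is
  the exterior derivative of that form on the five vectors.\<close>

definition alt5 :: "(nat \<Rightarrow> 'a) \<Rightarrow> ('a \<Rightarrow> 'a \<Rightarrow> 'a \<Rightarrow> 'a \<Rightarrow> 'a \<Rightarrow> real) \<Rightarrow> real" where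
  "alt5 e F = F (e 1) (e 2) (e 3) (e 4) (e 5) - F (e 2) (e 1) (e 3) (e 4) (e 5)
    + F (e 3) (e 1) (e 2) (e 4) (e 5) - F (e 4) (e 1) (e 2) (e 3) (e 5) + F (e 5) (e 1) (e 2) (e 3) (e 4)"

text \<open>This lemma and the next two are the terms of the Leibniz rule for
  \<open>d (a \<and> b \<and> C)\<close>: the derivative falls on \<open>a\<close>, on
  \<open>b\<close> with a minus sign, or on the closed form \<open>C\<close>, where nothing
  remains.\<close>

lemma alt5_wedge112_left:
  "alt5 e (\<lambda>u. wedge112 (\<lambda>v. A v u) b C) = wedge122 e b (\<lambda>v w. A w v - A v w) C"
  unfolding alt5_def wedge122_def wedge112_def wedge22_def by (simp add: algebra_simps)

lemma alt5_wedge112_mid: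
  "alt5 e (\<lambda>u. wedge112 a (\<lambda>v. B v u) C) = - wedge122 e a (\<lambda>v w. B w v - B v w) C"
  unfolding alt5_def wedge122_def wedge112_def wedge22_def by (simp add: algebra_simps)

text \<open>The hypothesis is closedness of \<open>C\<close>, with antisymmetry already applied and
  solved for one term, so that the ten increasing triples of indices serve as rewrite rules.\<close>

lemma alt5_wedge112_right:
  assumes c: "\<And>i j k. i \<in> {1..5} \<Longrightarrow> j \<in> {1..5} \<Longrightarrow> k \<in> {1..5} \<Longrightarrow>
     C (e j) (e k) (e i) = C (e i) (e k) (e j) - C (e i) (e j) (e k)"
  shows "alt5 e (\<lambda>u. wedge112 a b (\<lambda>v w. C v w u)) = 0"
proof -
  note cs = c[of 1 2 3] c[of 1 2 4] c[of 1 2 5] c[of 1 3 4] c[of 1 3 5] c[of 1 4 5]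
    c[of 2 3 4] c[of 2 3 5] c[of 2 4 5] c[of 3 4 5]
  show ?thesis
    unfolding alt5_def wedge112_def wedge22_def
    by (simp add: cs del: One_nat_def) (simp add: algebra_simps)
qed

lemma ext_deriv_wedge112:
  fixes C :: "'a::real_normed_vector \<Rightarrow> 'a \<Rightarrow> 'a \<Rightarrow> real"
  assumes a: "\<And>v. C1 (a v)" and b: "\<And>v. C1 (b v)" and C: "\<And>v w. C1 (C v w)"
    and anti: "\<And>v w x. C v w x = - C w v x"
    and closed: "\<And>i j k. i \<in> {1..5} \<Longrightarrow> j \<in> {1..5} \<Longrightarrow> k \<in> {1..5} \<Longrightarrow>
      dir_deriv (C (e j) (e k)) (e i) x + dir_deriv (C (e k) (e i)) (e j) x + dir_deriv (C (e i) (e j)) (e k) x = 0"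
  shows "wedge122 e (\<lambda>v. b v x) (\<lambda>v w. ext_deriv1 a v w x) (\<lambda>v w. C v w x) -
      wedge122 e (\<lambda>v. a v x) (\<lambda>v w. ext_deriv1 b v w x) (\<lambda>v w. C v w x) =
    alt5 e (\<lambda>u y z v w. dir_deriv (\<lambda>x. wedge112 (\<lambda>v. a v x) (\<lambda>v. b v x) (\<lambda>v w. C v w x) y z v w) u x)"
proof -
  have n: "C w v = (\<lambda>x. -1 * C v w x)" for v w
    by (rule ext) (use anti[of w v] in simp)
  have m: "dir_deriv (C w v) u x = - dir_deriv (C v w) u x" for u v w
    by (subst n[of w v]) (use dir_deriv_cmult[OF C, of "-1" v w u] in simp)
  have "alt5 e (\<lambda>u. wedge112 (\<lambda>v. a v x) (\<lambda>v. b v x) (\<lambda>v w. dir_deriv (C v w) u x)) = 0"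
  proof (rule alt5_wedge112_right)
    fix i j k :: nat assume "i \<in> {1..5}" "j \<in> {1..5}" "k \<in> {1..5}"
    from closed[OF this] show "dir_deriv (C (e j) (e k)) (e i) x = dir_deriv (C (e i) (e k)) (e j) x - dir_deriv (C (e i) (e j)) (e k) x"
      using m[where u = "e j" and v = "e i" and w = "e k"] by linarith
  qed
  moreover have "alt5 e (\<lambda>u y z v w. F u y z v w + G u y z v w + H u y z v w) = alt5 e F + alt5 e G + alt5 e H"
    for F G H :: "'a \<Rightarrow> 'a \<Rightarrow> 'a \<Rightarrow> 'a \<Rightarrow> 'a \<Rightarrow> real"
    by (simp add: alt5_def)
  ultimately show ?thesis
    using alt5_wedge112_left[of e "\<lambda>v u. dir_deriv (a v) u x" "\<lambda>v. b v x" "\<lambda>v w. C v w x"]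
      alt5_wedge112_mid[of e "\<lambda>v. a v x" "\<lambda>v u. dir_deriv (b v) u x" "\<lambda>v w. C v w x"]
    by (simp add: dir_deriv_wedge112[of a b C] a b C ext_deriv1_def)
qed

text \<open>The mean of \<open>d (a \<and> b \<and> C)\<close> vanishes by Stokes, and
  \<open>d C = 0\<close>, so \<open>d\<close> moves from \<open>a\<close> to \<open>b\<close>. The
  vectors \<open>e i\<close> enter only through the span of the periods, because the basis adapted
  to the monodromy is oblique to the lattice.\<close>

lemma torus_mean_wedge_by_parts:
  fixes C :: "'a::real_normed_vector \<Rightarrow> 'a \<Rightarrow> 'a \<Rightarrow> real"
  assumes a: "\<And>v. C1 (a v)" and b: "\<And>v. C1 (b v)" and C: "\<And>v w. C1 (C v w)"
    and anti: "\<And>v w x. C v w x = - C w v x"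
    and closed: "\<And>i j k x. i \<in> {1..5} \<Longrightarrow> j \<in> {1..5} \<Longrightarrow> k \<in> {1..5} \<Longrightarrow>
      dir_deriv (C (e j) (e k)) (e i) x + dir_deriv (C (e k) (e i)) (e j) x + dir_deriv (C (e i) (e j)) (e k) x = 0"
    and per: "\<And>V v x. V \<in> set Vs \<Longrightarrow> a v (x + V) = a v x" "\<And>V v x. V \<in> set Vs \<Longrightarrow> b v (x + V) = b v x"
      "\<And>V v w x. V \<in> set Vs \<Longrightarrow> C v w (x + V) = C v w x"
    and e: "\<And>i. i \<in> {1..5} \<Longrightarrow> e i \<in> span (set Vs)"
  shows "torus_mean Vs (\<lambda>x. wedge122 e (\<lambda>v. b v x) (\<lambda>v w. ext_deriv1 a v w x) (\<lambda>v w. C v w x)) =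
    torus_mean Vs (\<lambda>x. wedge122 e (\<lambda>v. a v x) (\<lambda>v w. ext_deriv1 b v w x) (\<lambda>v w. C v w x))"
proof -
  define G where "G y z v w x = wedge112 (\<lambda>v. a v x) (\<lambda>v. b v x) (\<lambda>v w. C v w x) y z v w"
    for y z v w x
  have G: "C1 (G y z v w)" for y z v w
    unfolding G_def wedge112_def wedge22_def by (intro C1_add C1_diff C1_mult assms(1-3))
  have Gper: "G y z v w (x + V) = G y z v w x" if "V \<in> set Vs" for y z v w x V
    unfolding G_def using that per by simp
  have m: "torus_mean Vs (dir_deriv (G y z v w) (e i)) = (\<lambda>x. 0)" if "i \<in> {1..5}" for y z v w i
    using torus_mean_dir_deriv_zero[OF G Gper e[OF that]] by blast
  let ?l = "\<lambda>x. wedge122 e (\<lambda>v. b v x) (\<lambda>v w. ext_deriv1 a v w x) (\<lambda>v w. C v w x)"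
  let ?r = "\<lambda>x. wedge122 e (\<lambda>v. a v x) (\<lambda>v w. ext_deriv1 b v w x) (\<lambda>v w. C v w x)"
  have cont: "continuous_on UNIV ?l" "continuous_on UNIV ?r"
    unfolding ext_deriv1_def
    by (intro continuous_wedge122 continuous_on_diff C1_cont C1_cont_dir_deriv assms(1-3))+
  have "(\<lambda>x. ?l x - ?r x) = (\<lambda>x. alt5 e (\<lambda>u y z v w. dir_deriv (G y z v w) u x))"
    unfolding G_def
    by (rule ext, rule ext_deriv_wedge112[where a = a and b = b and C = C and e = e]; fact assms)
  then have "torus_mean Vs (\<lambda>x. ?l x - ?r x) = (\<lambda>x. 0)"
    by (simp add: alt5_def torus_mean_add torus_mean_diff continuous_on_add continuous_on_diff C1_cont_dir_deriv[OF G] m)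
  then show ?thesis
    by (simp add: torus_mean_diff cont fun_eq_iff)
qed

text \<open>The factor is the determinant of \<open>G\<close> in the basis \<open>e\<close>: its
  blocks are the scaling by \<open>k\<close>, multiplication by the complex number
  \<open>p + q \<i>\<close>, and a quarter turn of determinant 1.\<close>

lemma wedge122_pullback:
  assumes a: "linear a" and B: "bilinear B" "\<And>v w. B v w = - B w v" and C: "bilinear C" "\<And>v w. C v w = - C w v"
    and G: "G (e 1) = k *\<^sub>R e 1" "G (e 2) = p *\<^sub>R e 2 + q *\<^sub>R e 3" "G (e 3) = p *\<^sub>R e 3 - q *\<^sub>R e 2"
      "G (e 4) = e 5" "G (e 5) = - e 4"
  shows "wedge122 e (\<lambda>v. a (G v)) (\<lambda>v w. B (G v) (G w)) (\<lambda>v w. C (G v) (G w)) =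
    k * (p\<^sup>2 + q\<^sup>2) * wedge122 e a B C"
proof -
  have z: "B v v = 0" "C v v = 0" for v
    using B(2)[of v v] C(2)[of v v] by auto
  show ?thesis
    unfolding wedge122_def wedge22_def G
    by (simp add: linear_add[OF a] linear_diff[OF a] linear_neg[OF a] linear_cmul[OF a] z
      bilinear_ladd[OF B(1)] bilinear_radd[OF B(1)] bilinear_lsub[OF B(1)] bilinear_rsub[OF B(1)]
      bilinear_lneg[OF B(1)] bilinear_rneg[OF B(1)] bilinear_lmul[OF B(1)] bilinear_rmul[OF B(1)]
      bilinear_ladd[OF C(1)] bilinear_radd[OF C(1)] bilinear_lsub[OF C(1)] bilinear_rsub[OF C(1)]
      bilinear_lneg[OF C(1)] bilinear_rneg[OF C(1)] bilinear_lmul[OF C(1)] bilinear_rmul[OF C(1)],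
      simp add: B(2)[of "e 3" "e 2"] B(2)[of "e 5" "e 4"] C(2)[of "e 3" "e 2"] C(2)[of "e 5" "e 4"],
      simp add: algebra_simps power2_eq_square)
qed

section \<open>Linear algebra at a point: nondegenerate forms and forms invariant under the
  monodromy\<close>

lemma two_kernel_vectors:
  fixes \<omega> :: "'a::real_vector \<Rightarrow> 'a \<Rightarrow> real"
  assumes bil: "bilinear \<omega>" and anti: "\<And>v w. \<omega> v w = - \<omega> w v"
    and nd: "\<And>v. \<forall>w. \<omega> v w = 0 \<Longrightarrow> v = 0" and span: "span (insert T E) = UNIV"
    and x: "\<And>v. v \<in> E \<Longrightarrow> \<omega> x v = 0" and y: "\<And>v. v \<in> E \<Longrightarrow> \<omega> y v = 0"
  shows "\<exists>r s. (r, s) \<noteq> (0, 0) \<and> r *\<^sub>R x + s *\<^sub>R y = 0"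
proof -
  note b = bilinear_ladd[OF bil] bilinear_radd[OF bil] bilinear_lmul[OF bil] bilinear_rmul[OF bil]
    bilinear_lzero[OF bil] bilinear_rzero[OF bil] bilinear_lsub[OF bil]
  have zero: "v = 0" if "\<omega> v T = 0" "\<And>w. w \<in> E \<Longrightarrow> \<omega> v w = 0" for v
  proof (rule nd, rule allI)
    fix w
    have "w \<in> span (insert T E)" using span by simp
    then show "\<omega> v w = 0"
      by (induction rule: span_induct_alt) (use that in \<open>auto simp: b\<close>)
  qed
  \<comment> \<open>The coefficients are chosen so that this combination pairs to zero with
    \<open>T\<close> as well as with \<open>E\<close>; nondegeneracy then kills it.\<close>
  have 1: "\<omega> y T *\<^sub>R x - \<omega> x T *\<^sub>R y = 0"
    by (rule zero) (simp_all add: b x y)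
  show ?thesis
  proof (cases "\<omega> x T = 0")
    case True
    then have "x = 0" using zero x by blast
    then show ?thesis by (intro exI[of _ 1] exI[of _ 0]) simp
  next
    case False
    with 1 show ?thesis by (intro exI[of _ "\<omega> y T"] exI[of _ "- \<omega> x T"]) simp
  qed
qed

text \<open>The equations in \<open>pf\<close> are the vanishing of the 4 by 4 Pfaffians containing
  \<open>p1\<close> and \<open>p2\<close>. They make the form of rank two on the five vectors, which
  leaves a kernel of dimension at least two there, more than a nondegenerate form allows on a
  hyperplane.\<close>

lemma rank_two_degenerate:
  fixes \<omega> :: "'a::real_vector \<Rightarrow> 'a \<Rightarrow> real"
  assumes bil: "bilinear \<omega>" and anti: "\<And>v w. \<omega> v w = - \<omega> w v"
    and nd: "\<And>v. \<forall>w. \<omega> v w = 0 \<Longrightarrow> v = 0" and span: "span {T, p1, p2, p3, p4, p5} = UNIV"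
    and indep: "\<And>r s t u. r *\<^sub>R p1 + s *\<^sub>R p2 + t *\<^sub>R p3 + u *\<^sub>R p4 = 0 \<Longrightarrow> t = 0 \<and> u = 0"
    and ne: "\<omega> p1 p2 \<noteq> 0"
    and pf: "\<omega> p1 p2 * \<omega> p3 p4 - \<omega> p1 p3 * \<omega> p2 p4 + \<omega> p1 p4 * \<omega> p2 p3 = 0"
      "\<omega> p1 p2 * \<omega> p3 p5 - \<omega> p1 p3 * \<omega> p2 p5 + \<omega> p1 p5 * \<omega> p2 p3 = 0"
      "\<omega> p1 p2 * \<omega> p4 p5 - \<omega> p1 p4 * \<omega> p2 p5 + \<omega> p1 p5 * \<omega> p2 p4 = 0"
  shows False
proof -
  note b = bilinear_ladd[OF bil] bilinear_lsub[OF bil] bilinear_lmul[OF bil]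
  have z: "\<omega> v v = 0" for v using anti[of v v] by simp
  note a = anti[of p2 p1] anti[of p3 p1] anti[of p4 p1] anti[of p3 p2] anti[of p4 p2] anti[of p4 p3]
  \<comment> \<open>\<open>x\<close> and \<open>y\<close> are \<open>p3\<close> and
    \<open>p4\<close> made orthogonal to \<open>p1\<close> and \<open>p2\<close>, multiplied by
    \<open>\<omega> p1 p2\<close> to avoid division. The Pfaffian equations are what makes them
    orthogonal to the remaining vectors too.\<close>
  define x where "x = \<omega> p1 p2 *\<^sub>R p3 + \<omega> p2 p3 *\<^sub>R p1 - \<omega> p1 p3 *\<^sub>R p2"
  define y where "y = \<omega> p1 p2 *\<^sub>R p4 + \<omega> p2 p4 *\<^sub>R p1 - \<omega> p1 p4 *\<^sub>R p2"
  have "\<omega> x v = 0" "\<omega> y v = 0" if "v \<in> {p1, p2, p3, p4, p5}" for v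
    using that pf by (auto simp: x_def y_def b z a algebra_simps)
  from two_kernel_vectors[OF bil anti nd span this]
  obtain r s where rs: "(r, s) \<noteq> (0, 0)" "r *\<^sub>R x + s *\<^sub>R y = 0"
    by auto
  have "(r * \<omega> p2 p3 + s * \<omega> p2 p4) *\<^sub>R p1 + (- r * \<omega> p1 p3 - s * \<omega> p1 p4) *\<^sub>R p2
      + (r * \<omega> p1 p2) *\<^sub>R p3 + (s * \<omega> p1 p2) *\<^sub>R p4 = 0"
    using rs(2) by (simp add: x_def y_def algebra_simps)
  from indep[OF this] rs(1) ne show False by simp
qed

text \<open>The Pfaffians of the 4 by 4 minors form a vector \<open>k\<close> in the kernel of the
  restricted form, and the volume is twice the pairing of \<open>T\<close> with \<open>k\<close>. If
  the volume is zero, then \<open>k\<close> lies in the kernel of \<open>\<omega>\<close> itself, so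
  all these Pfaffians vanish and the restricted form has rank at most two, which is
  impossible.\<close>

lemma wedge122_nondegenerate:
  fixes \<omega> :: "'a::real_vector \<Rightarrow> 'a \<Rightarrow> real" and e :: "nat \<Rightarrow> 'a"
  assumes bil: "bilinear \<omega>" and anti: "\<And>v w. \<omega> v w = - \<omega> w v"
    and nd: "\<And>v. \<forall>w. \<omega> v w = 0 \<Longrightarrow> v = 0" and span: "span {T, e 1, e 2, e 3, e 4, e 5} = UNIV"
    and indep: "\<And>r1 r2 r3 r4 r5. r1 *\<^sub>R e 1 + r2 *\<^sub>R e 2 + r3 *\<^sub>R e 3 + r4 *\<^sub>R e 4 + r5 *\<^sub>R e 5 = 0 \<Longrightarrow>
      r1 = 0 \<and> r2 = 0 \<and> r3 = 0 \<and> r4 = 0 \<and> r5 = 0"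
  shows "wedge122 e (\<omega> T) \<omega> \<omega> \<noteq> 0"
proof
  assume 0: "wedge122 e (\<omega> T) \<omega> \<omega> = 0"
  note b = bilinear_ladd[OF bil] bilinear_radd[OF bil] bilinear_lmul[OF bil] bilinear_rmul[OF bil]
    bilinear_lsub[OF bil] bilinear_rsub[OF bil] bilinear_lzero[OF bil] bilinear_rzero[OF bil]
  have z: "\<omega> v v = 0" for v using anti[of v v] by simp
  note an = anti[of "e 2" "e 1"] anti[of "e 3" "e 1"] anti[of "e 4" "e 1"] anti[of "e 5" "e 1"]
    anti[of "e 3" "e 2"] anti[of "e 4" "e 2"] anti[of "e 5" "e 2"]
    anti[of "e 4" "e 3"] anti[of "e 5" "e 3"] anti[of "e 5" "e 4"]
  define pf where "pf x y v w = \<omega> x y * \<omega> v w - \<omega> x v * \<omega> y w + \<omega> x w * \<omega> y v" for x y v w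
  define R1 R2 R3 R4 R5 where R: "R1 = pf (e 2) (e 3) (e 4) (e 5)" "R2 = pf (e 1) (e 3) (e 4) (e 5)"
    "R3 = pf (e 1) (e 2) (e 4) (e 5)" "R4 = pf (e 1) (e 2) (e 3) (e 5)" "R5 = pf (e 1) (e 2) (e 3) (e 4)"
  \<comment> \<open>The alternating signs are those of the cofactor expansion of a 5 by 5
    antisymmetric matrix; they make \<open>k\<close> orthogonal to every \<open>e i\<close>.\<close>
  define k where "k = R1 *\<^sub>R e 1 - R2 *\<^sub>R e 2 + R3 *\<^sub>R e 3 - R4 *\<^sub>R e 4 + R5 *\<^sub>R e 5"
  have "2 * \<omega> T k = wedge122 e (\<omega> T) \<omega> \<omega>"
    unfolding k_def wedge122_def wedge22_def R pf_def by (simp add: b algebra_simps)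
  with 0 anti[of k T] have kT: "\<omega> k T = 0" by simp
  have kE: "\<omega> k v = 0" if "v \<in> {e 1, e 2, e 3, e 4, e 5}" for v
    using that unfolding k_def R pf_def
    by (auto simp: b z an algebra_simps simp del: One_nat_def)
  have "k = 0"
  proof (rule nd, rule allI)
    fix w
    have "w \<in> span {T, e 1, e 2, e 3, e 4, e 5}" using span by simp
    then show "\<omega> k w = 0"
      by (induction rule: span_induct_alt) (use kT kE in \<open>auto simp: b\<close>)
  qed
  then have "R1 *\<^sub>R e 1 + (- R2) *\<^sub>R e 2 + R3 *\<^sub>R e 3 + (- R4) *\<^sub>R e 4 + R5 *\<^sub>R e 5 = 0"
    by (simp add: k_def)
  from indep[OF this] have R0: "R1 = 0" "R2 = 0" "R3 = 0" "R4 = 0" "R5 = 0" by auto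
  note pf0 = R0[unfolded R pf_def]
  have indep': "t = 0 \<and> u = 0"
    if "r *\<^sub>R e i + s *\<^sub>R e j + t *\<^sub>R e m + u *\<^sub>R e n = 0"
      and il: "distinct [i, j, m, n, l]" "{i, j, m, n, l} = {1, 2, 3, 4, 5}" for i j m n l r s t u
  proof -
    define f where "f a = (if a = i then r else if a = j then s else if a = m then t else if a = n then u else 0)" for a
    have "(\<Sum>a\<in>{i, j, m, n, l}. f a *\<^sub>R e a) = 0"
      using il(1) that(1) by (auto simp: f_def add.assoc)
    then have "f 1 *\<^sub>R e 1 + f 2 *\<^sub>R e 2 + f 3 *\<^sub>R e 3 + f 4 *\<^sub>R e 4 + f 5 *\<^sub>R e 5 = 0"
      unfolding il(2) by (simp add: add.assoc)
    from indep[OF this] have "\<forall>a\<in>{1, 2, 3, 4, 5}. f a = 0" by auto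
    then have "f m = 0" "f n = 0" unfolding il(2)[symmetric] by auto
    then show ?thesis using il(1) by (auto simp: f_def)
  qed
  \<comment> \<open>A nonzero entry would put \<open>e i\<close> and \<open>e j\<close> in the place
    of \<open>p1\<close> and \<open>p2\<close> in \<open>rank_two_degenerate\<close>.\<close>
  have zero: "\<omega> (e i) (e j) = 0"
    if il: "distinct [i, j, m, n, l]" "{i, j, m, n, l} = {1, 2, 3, 4, 5}"
      and pf: "pf (e i) (e j) (e m) (e n) = 0" "pf (e i) (e j) (e m) (e l) = 0" "pf (e i) (e j) (e n) (e l) = 0"
    for i j m n l
  proof (rule ccontr)
    assume ne: "\<omega> (e i) (e j) \<noteq> 0"
    have "e ` {i, j, m, n, l} = e ` {1, 2, 3, 4, 5}" using il(2) by simp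
    then have "span {T, e i, e j, e m, e n, e l} = UNIV"
      using span by simp
    note sp = this
    have ind: "t = 0 \<and> u = 0" if "r *\<^sub>R e i + s *\<^sub>R e j + t *\<^sub>R e m + u *\<^sub>R e n = 0" for r s t u
      using indep'[OF that il] .
    show False
      by (rule rank_two_degenerate[OF bil anti nd sp ind ne pf[unfolded pf_def]])
  qed
  \<comment> \<open>These seven entries put \<open>e 1\<close> and \<open>e 2\<close> in the kernel
    of the restricted form, two independent vectors where only a line has room.\<close>
  have ze: "\<omega> (e 1) (e 2) = 0" "\<omega> (e 1) (e 3) = 0" "\<omega> (e 1) (e 4) = 0" "\<omega> (e 1) (e 5) = 0"
    "\<omega> (e 2) (e 3) = 0" "\<omega> (e 2) (e 4) = 0" "\<omega> (e 2) (e 5) = 0"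
    by (rule zero[of 1 2 3 4 5] zero[of 1 3 2 4 5] zero[of 1 4 2 3 5] zero[of 1 5 2 3 4]
        zero[of 2 3 1 4 5] zero[of 2 4 1 3 5] zero[of 2 5 1 3 4];
      use pf0 in \<open>auto simp: pf_def an algebra_simps simp del: One_nat_def\<close>)+
  have "\<omega> (e 1) v = 0" "\<omega> (e 2) v = 0" if "v \<in> {e 1, e 2, e 3, e 4, e 5}" for v
    using that ze z an(1) by (auto simp del: One_nat_def)
  from two_kernel_vectors[OF bil anti nd span this]
  obtain r s where rs: "(r, s) \<noteq> (0, 0)" "r *\<^sub>R e 1 + s *\<^sub>R e 2 = 0"
    by auto
  from rs(2) have "r *\<^sub>R e 1 + s *\<^sub>R e 2 + 0 *\<^sub>R e 3 + 0 *\<^sub>R e 4 + 0 *\<^sub>R e 5 = 0"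
    by simp
  from indep[OF this] rs(1) show False by simp
qed

lemma wedge122_cong:
  assumes "\<And>i. i \<in> {1..5} \<Longrightarrow> a (e i) = a' (e i)"
    and "\<And>i j. i \<in> {1..5} \<Longrightarrow> j \<in> {1..5} \<Longrightarrow> B (e i) (e j) = B' (e i) (e j)"
    and "\<And>i j. i \<in> {1..5} \<Longrightarrow> j \<in> {1..5} \<Longrightarrow> C (e i) (e j) = C' (e i) (e j)"
  shows "wedge122 e a B C = wedge122 e a' B' C'"
  using assms unfolding wedge122_def wedge22_def by simp

text \<open>On two-forms \<open>G\<close> has as eigenvalues the products of two of
  \<open>k\<close>, \<open>p + q \<i>\<close>, \<open>p - q \<i>\<close>, \<open>\<i>\<close>,
  \<open>-\<i>\<close>. All of them have modulus different from 1 except the product of the last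
  two, so only \<open>b (e 4) (e 5)\<close> can survive. The computation stays real by comparing
  sums of squares on each block.\<close>

lemma invariant_form_decomposable:
  fixes b :: "'a::real_vector \<Rightarrow> 'a \<Rightarrow> real"
  assumes bil: "bilinear b" and anti: "\<And>v w. b v w = - b w v"
    and inv: "\<And>i j. i \<in> {1..5} \<Longrightarrow> j \<in> {1..5} \<Longrightarrow> b (G (e i)) (G (e j)) = b (e i) (e j)"
    and k: "k > 1" "k * (p\<^sup>2 + q\<^sup>2) = 1"
    and G: "G (e 1) = k *\<^sub>R e 1" "G (e 2) = p *\<^sub>R e 2 + q *\<^sub>R e 3" "G (e 3) = p *\<^sub>R e 3 - q *\<^sub>R e 2"
      "G (e 4) = e 5" "G (e 5) = - e 4"
  shows "wedge122 e a b b = 0"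
proof -
  note l = bilinear_ladd[OF bil] bilinear_radd[OF bil] bilinear_lsub[OF bil] bilinear_rsub[OF bil]
      bilinear_lneg[OF bil] bilinear_rneg[OF bil] bilinear_lmul[OF bil] bilinear_rmul[OF bil]
  have z: "b v v = 0" for v using anti[of v v] by simp
  \<comment> \<open>Here \<open>r\<close> is the squared modulus of the eigenvalues on a block with
    the two real coordinates \<open>x\<close> and \<open>y\<close>.\<close>
  have zero: "x = 0 \<and> y = 0" if "r * (x\<^sup>2 + y\<^sup>2) = x\<^sup>2 + y\<^sup>2" "r \<noteq> 1" for r x y :: real
    using that mult_cancel_right1[of "x\<^sup>2 + y\<^sup>2" r] mult_cancel_right2[of r "x\<^sup>2 + y\<^sup>2"]
    by (simp add: sum_power2_eq_zero_iff)
  have pq: "p\<^sup>2 + q\<^sup>2 \<noteq> 1" using k by auto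
  have kk: "k\<^sup>2 * (p\<^sup>2 + q\<^sup>2) = k" "k\<^sup>2 \<noteq> 1" 
    using k less_1_mult[OF k(1) k(1)] by (auto simp: power2_eq_square mult.assoc)
  have 12: "k * (p * b (e 1) (e 2) + q * b (e 1) (e 3)) = b (e 1) (e 2)"
    and 13: "k * (p * b (e 1) (e 3) - q * b (e 1) (e 2)) = b (e 1) (e 3)"
    and 14: "k * b (e 1) (e 5) = b (e 1) (e 4)" and 15: "- k * b (e 1) (e 4) = b (e 1) (e 5)"
    and 23: "(p\<^sup>2 + q\<^sup>2) * b (e 2) (e 3) = b (e 2) (e 3)"
    and 24: "p * b (e 2) (e 5) + q * b (e 3) (e 5) = b (e 2) (e 4)"
    and 25: "- p * b (e 2) (e 4) - q * b (e 3) (e 4) = b (e 2) (e 5)"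
    and 34: "p * b (e 3) (e 5) - q * b (e 2) (e 5) = b (e 3) (e 4)"
    and 35: "- p * b (e 3) (e 4) + q * b (e 2) (e 4) = b (e 3) (e 5)"
    using inv[of 1 2] inv[of 1 3] inv[of 1 4] inv[of 1 5] inv[of 2 3] inv[of 2 4] inv[of 2 5] inv[of 3 4] inv[of 3 5]
      anti[of "e 3" "e 2"]
    unfolding G by (simp_all add: l z power2_eq_square algebra_simps del: One_nat_def)
  have "k * ((b (e 1) (e 2))\<^sup>2 + (b (e 1) (e 3))\<^sup>2) = k\<^sup>2 * (p\<^sup>2 + q\<^sup>2) * ((b (e 1) (e 2))\<^sup>2 + (b (e 1) (e 3))\<^sup>2)"
    using kk by simp
  also have "\<dots> = (k * (p * b (e 1) (e 2) + q * b (e 1) (e 3)))\<^sup>2 + (k * (p * b (e 1) (e 3) - q * b (e 1) (e 2)))\<^sup>2"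
    by (simp add: power2_eq_square algebra_simps)
  finally have 1: "b (e 1) (e 2) = 0" "b (e 1) (e 3) = 0"
    unfolding 12 13 using zero[of k "b (e 1) (e 2)" "b (e 1) (e 3)"] k(1) by simp_all
  have "k\<^sup>2 * ((b (e 1) (e 4))\<^sup>2 + (b (e 1) (e 5))\<^sup>2) = (k * b (e 1) (e 5))\<^sup>2 + (- k * b (e 1) (e 4))\<^sup>2"
    by (simp add: power2_eq_square algebra_simps)
  then have 2: "b (e 1) (e 4) = 0" "b (e 1) (e 5) = 0"
    unfolding 14 15 using zero[of "k\<^sup>2" "b (e 1) (e 5)" "b (e 1) (e 4)"] kk(2) by (simp_all add: add.commute)
  have 3: "b (e 2) (e 3) = 0"
    using 23 pq by simp
  \<comment> \<open>These four entries form one block: a complex multiplication on the indices 2, 3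
    and a quarter turn on 4, 5 together scale the sum of squares by
    \<open>p\<^sup>2 + q\<^sup>2\<close>.\<close>
  let ?s = "(b (e 2) (e 4))\<^sup>2 + (b (e 2) (e 5))\<^sup>2 + (b (e 3) (e 4))\<^sup>2 + (b (e 3) (e 5))\<^sup>2"
  have "(p\<^sup>2 + q\<^sup>2) * ?s = (p * b (e 2) (e 5) + q * b (e 3) (e 5))\<^sup>2 + (- p * b (e 2) (e 4) - q * b (e 3) (e 4))\<^sup>2 +
      (p * b (e 3) (e 5) - q * b (e 2) (e 5))\<^sup>2 + (- p * b (e 3) (e 4) + q * b (e 2) (e 4))\<^sup>2"
    by (simp add: power2_eq_square algebra_simps)
  then have "?s = 0"
    unfolding 24 25 34 35 using pq by simp
  then have 4: "b (e 2) (e 4) = 0" "b (e 2) (e 5) = 0" "b (e 3) (e 4) = 0" "b (e 3) (e 5) = 0"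
    by (smt (verit) zero_le_power2 zero_eq_power2)+
  show ?thesis
    unfolding wedge122_def wedge22_def by (simp add: 1 2 3 4 del: One_nat_def)
qed

section \<open>Integration in the time direction, starting from time 0\<close>

definition time_int :: "(real \<times> 'b::real_normed_vector \<Rightarrow> real) \<Rightarrow> real \<times> 'b \<Rightarrow> real" where
  "time_int f x = fst x * integral {0..1} (\<lambda>s. f (s * fst x, snd x))"

lemma continuous_time_scale:
  fixes f :: "real \<times> 'b::real_normed_vector \<Rightarrow> real"
  assumes "continuous_on UNIV f"
  shows "continuous_on UNIV (\<lambda>(x, s). f (s * fst x, snd x))"
  unfolding case_prod_beta by (rule continuous_comp[OF assms]) (intro continuous_intros)

lemma time_integrable:
  fixes f :: "real \<times> 'b::real_normed_vector \<Rightarrow> real"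
  assumes "continuous_on UNIV f"
  shows "(\<lambda>s. f (s * t, y)) integrable_on {0..1}"
  by (rule integrable_continuous_real, rule continuous_comp[OF assms]) (intro continuous_intros)

lemma time_int_add:
  assumes "continuous_on UNIV f" "continuous_on UNIV g"
  shows "time_int (\<lambda>x. f x + g x) x = time_int f x + time_int g x"
  using integral_add[OF time_integrable[OF assms(1), of "fst x" "snd x"] time_integrable[OF assms(2), of "fst x" "snd x"]]
  by (simp add: time_int_def distrib_left)

lemma time_int_cmult: "time_int (\<lambda>x. k * f x) x = k * time_int f x"
  by (simp add: time_int_def)

lemma time_int_diff:
  assumes "continuous_on UNIV f" "continuous_on UNIV g"
  shows "time_int (\<lambda>x. f x - g x) x = time_int f x - time_int g x"
  using integral_diff[OF time_integrable[OF assms(1), of "fst x" "snd x"] time_integrable[OF assms(2), of "fst x" "snd x"]]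
  by (simp add: time_int_def right_diff_distrib)

lemma time_int_linear:
  assumes "\<And>v. continuous_on UNIV (\<eta> v)" "\<And>x. linear (\<lambda>v. \<eta> v x)"
  shows "linear (\<lambda>v. time_int (\<eta> v) x)"
proof
  fix v w and k :: real
  have "\<eta> (v + w) = (\<lambda>x. \<eta> v x + \<eta> w x)"
    using linear_add[OF assms(2)] by blast
  then show "time_int (\<eta> (v + w)) x = time_int (\<eta> v) x + time_int (\<eta> w) x"
    by (simp add: time_int_add assms)
  have "\<eta> (k *\<^sub>R v) = (\<lambda>x. k * \<eta> v x)"
    using linear_cmul[OF assms(2)] by auto
  then show "time_int (\<eta> (k *\<^sub>R v)) x = k *\<^sub>R time_int (\<eta> v) x"
    by (simp add: time_int_cmult)
qed

text \<open>The integral from 0 to \<open>fst x\<close> is rescaled to the unit interval, which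
  makes it a parameter integral covered by \<open>C1_integral\<close>. The price is that its time
  derivative is no longer immediate from the fundamental theorem.\<close>

lemma
  fixes f :: "real \<times> 'b::real_normed_vector \<Rightarrow> real"
  assumes f: "C1 f"
  shows C1_time_int: "C1 (time_int f)"
    and dir_deriv_time_int_fibre: "dir_deriv (time_int f) (0, v) = time_int (dir_deriv f (0, v))"
    and dir_deriv_time_int: "dir_deriv (time_int f) (1, 0) = f"
    and time_int_dir_deriv: "time_int (dir_deriv f (1, 0)) x = f x - f (0, snd x)"
proof -
  have bl: "bounded_linear (\<lambda>x::real \<times> 'b. (s * fst x, snd x))" for s
    by (intro bounded_linear_Pair bounded_linear_const_mult bounded_linear_fst bounded_linear_snd)
  have h: "C1 (\<lambda>x. f (s * fst x, snd x))" for s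
    using C1_affine[OF f bl, of 0 s] by simp
  have dh: "dir_deriv (\<lambda>x. f (s * fst x, snd x)) v = (\<lambda>x. dir_deriv f (s * fst v, snd v) (s * fst x, snd x))" for s v
    using dir_deriv_affine[OF f bl, of 0 s v] by simp
  have dl: "dir_deriv f (s * fst v, snd v) x = s * (fst v * dir_deriv f (1, 0) x) + dir_deriv f (0, snd v) x" for s x and v :: "real \<times> 'b"
  proof -
    have "(s * fst v, snd v) = (s * fst v) *\<^sub>R (1, 0) + (0, snd v)" by simp
    then show ?thesis
      by (simp only: linear_add[OF linear_dir_deriv[OF f]] linear_cmul[OF linear_dir_deriv[OF f]] real_scaleR_def mult.assoc)
  qed
  have c0: "continuous_on UNIV (\<lambda>(x, s). f (s * fst x, snd x))"
    by (rule continuous_time_scale[OF C1_cont[OF f]])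
  have c1: "continuous_on UNIV (\<lambda>(x, s). dir_deriv (\<lambda>x. f (s * fst x, snd x)) v x)" for v
    using continuous_time_scale[OF C1_cont_dir_deriv[OF f, of "(1, 0)"]] continuous_time_scale[OF C1_cont_dir_deriv[OF f, of "(0, snd v)"]]
    unfolding dh dl case_prod_beta by (intro continuous_intros)
  note I = C1_integral[of "\<lambda>x s. f (s * fst x, snd x)", OF h c0 c1]
    dir_deriv_integral[of "\<lambda>x s. f (s * fst x, snd x)", OF h c0 c1]
  have F: "C1 (fst :: real \<times> 'b \<Rightarrow> real)" "dir_deriv (fst :: real \<times> 'b \<Rightarrow> real) v = (\<lambda>x. fst v)" for v
    by (rule C1I[of "fst :: real \<times> 'b \<Rightarrow> real" "\<lambda>v x. fst v"];
        auto intro!: continuous_intros derivative_eq_intros simp: linear_iff)+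
  show "C1 (time_int f)"
    unfolding time_int_def[abs_def] by (intro C1_mult F I)
  have d: "dir_deriv (time_int f) v x = fst v * integral {0..1} (\<lambda>s. f (s * fst x, snd x)) +
      fst x * integral {0..1} (\<lambda>s. dir_deriv f (s * fst v, snd v) (s * fst x, snd x))" for v x
    unfolding time_int_def[abs_def] by (simp add: dir_deriv_mult F I dh)
  show "dir_deriv (time_int f) (0, v) = time_int (dir_deriv f (0, v))"
    by (rule ext) (simp add: d time_int_def)
  have s: "((\<lambda>s. f (s * fst x, snd x)) has_real_derivative fst x * dir_deriv f (1, 0) (s * fst x, snd x)) (at s within S)" for s x S
  proof -
    have "((\<lambda>s. f ((0, snd x) + s *\<^sub>R (fst x, 0))) has_real_derivative
        dir_deriv f (fst x *\<^sub>R (1, 0)) ((0, snd x) + s *\<^sub>R (fst x, 0))) (at s within S)"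
      using C1_deriv[OF f, of "(0, snd x)" "(fst x, 0)" s S] by simp
    then show ?thesis
      unfolding dir_deriv_scaleR[OF f] by simp
  qed
  \<comment> \<open>The integrand is the derivative of \<open>s * f (s * fst x, snd x)\<close> in
    \<open>s\<close>, exactly the expression left by differentiating the rescaled integral.\<close>
  have fi: "((\<lambda>s. f (s * fst x, snd x) + s * (fst x * dir_deriv f (1, 0) (s * fst x, snd x))) has_integral
      1 * f (1 * fst x, snd x) - 0 * f (0 * fst x, snd x)) {0..1}" for x
    by (rule fundamental_theorem_of_calculus)
      (auto intro!: derivative_eq_intros s simp: has_real_derivative_iff_has_vector_derivative[symmetric])
  have e: "integral {0..1} (\<lambda>s. f (s * fst x, snd x) + s * (fst x * dir_deriv f (1, 0) (s * fst x, snd x))) = f x" for x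
    using integral_unique[OF fi[of x]] by simp
  show "dir_deriv (time_int f) (1, 0) = f"
  proof
    fix x
    have i: "(\<lambda>s. s * (fst x * dir_deriv f (1, 0) (s * fst x, snd x))) integrable_on {0..1}"
      by (rule integrable_continuous_real, intro continuous_on_mult continuous_on_id continuous_on_const
          continuous_comp[OF C1_cont_dir_deriv[OF f]]) (intro continuous_intros)
    have dd0: "dir_deriv f (0, 0) y = 0" for y
      using linear_0[OF linear_dir_deriv[OF f]] by (simp add: zero_prod_def)
    have "dir_deriv (time_int f) (1, 0) x = integral {0..1} (\<lambda>s. f (s * fst x, snd x)) +
       integral {0..1} (\<lambda>s. s * (fst x * dir_deriv f (1, 0) (s * fst x, snd x)))"
      unfolding d dl by (simp add: dd0 mult.left_commute[of _ "fst x"])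
    also have "\<dots> = f x"
      using integral_add[OF time_integrable[OF C1_cont[OF f], of "fst x" "snd x"] i] e[of x] by simp
    finally show "dir_deriv (time_int f) (1, 0) x = f x" .
  qed
  have "((\<lambda>s. fst x * dir_deriv f (1, 0) (s * fst x, snd x)) has_integral f (1 * fst x, snd x) - f (0 * fst x, snd x)) {0..1}"
    by (rule fundamental_theorem_of_calculus)
      (auto intro!: s simp: has_real_derivative_iff_has_vector_derivative[symmetric])
  then show "time_int (dir_deriv f (1, 0)) x = f x - f (0, snd x)"
    by (auto dest: integral_unique simp: time_int_def)
qed

section \<open>Symplectic forms on the covering space\<close>

definition time_dir :: solv where "time_dir = (1, 0, 0, 0)"

declare split_paired_All [simp del] split_paired_Ex [simp del]

text \<open>The entry at index 0 is a filler, so that the indices run from 1 to 5 as in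
  \<open>wedge122\<close>. The vectors at 2, 3 and at 4, 5 are the real and imaginary directions of
  the two complex factors.\<close>

definition fibre_basis :: "nat \<Rightarrow> solv" where
  "fibre_basis i = [0, (0, 1, 0, 0), (0, 0, 1, 0), (0, 0, \<i>, 0), (0, 0, 0, 1), (0, 0, 0, \<i>)] ! i"

text \<open>The linear part of the generator \<open>g_0\<close>, which acts on the covering space by
  \<open>time_dir + monodromy c \<alpha> x\<close>.\<close>

definition monodromy :: "real \<Rightarrow> complex \<Rightarrow> solv \<Rightarrow> solv" where
  "monodromy c \<alpha> v = (fst v, c * fst (snd v), \<alpha> * fst (snd (snd v)), \<i> * snd (snd (snd v)))"

lemma fibre_basis_simps:
  "fibre_basis 1 = (0, 1, 0, 0)" "fibre_basis (Suc 0) = (0, 1, 0, 0)" "fibre_basis 2 = (0, 0, 1, 0)"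
  "fibre_basis 3 = (0, 0, \<i>, 0)" "fibre_basis 4 = (0, 0, 0, 1)" "fibre_basis 5 = (0, 0, 0, \<i>)"
  by (simp_all add: fibre_basis_def)

lemma fst_fibre_basis: "i \<in> {1..5} \<Longrightarrow> fst (fibre_basis i) = 0"
proof -
  assume "i \<in> {1..5}"
  then have "i = 1 \<or> i = 2 \<or> i = 3 \<or> i = 4 \<or> i = 5" by auto
  then show ?thesis by (auto simp: fibre_basis_simps)
qed

lemma bounded_linear_monodromy: "bounded_linear (monodromy c \<alpha>)"
  unfolding monodromy_def[abs_def]
  by (intro bounded_linear_Pair bounded_linear_mult_right[THEN bounded_linear_compose] bounded_linear_fst
      bounded_linear_compose[OF bounded_linear_fst] bounded_linear_snd bounded_linear_compose[OF bounded_linear_snd])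

lemma monodromy_fibre_basis:
  "monodromy c \<alpha> (fibre_basis 1) = c *\<^sub>R fibre_basis 1"
  "monodromy c \<alpha> (fibre_basis 2) = Re \<alpha> *\<^sub>R fibre_basis 2 + Im \<alpha> *\<^sub>R fibre_basis 3"
  "monodromy c \<alpha> (fibre_basis 3) = Re \<alpha> *\<^sub>R fibre_basis 3 - Im \<alpha> *\<^sub>R fibre_basis 2"
  "monodromy c \<alpha> (fibre_basis 4) = fibre_basis 5"
  "monodromy c \<alpha> (fibre_basis 5) = - fibre_basis 4"
  by (simp_all add: fibre_basis_simps monodromy_def complex_eq_iff del: One_nat_def)

lemma solv_expansion:
  "v = fst v *\<^sub>R time_dir + (fst (snd v) *\<^sub>R fibre_basis 1 + Re (fst (snd (snd v))) *\<^sub>R fibre_basis 2 +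
    Im (fst (snd (snd v))) *\<^sub>R fibre_basis 3 + Re (snd (snd (snd v))) *\<^sub>R fibre_basis 4 + Im (snd (snd (snd v))) *\<^sub>R fibre_basis 5)"
  by (cases v) (simp add: time_dir_def fibre_basis_simps complex_eq_iff del: One_nat_def)

lemma span_solv:
  "span {time_dir, fibre_basis 1, fibre_basis 2, fibre_basis 3, fibre_basis 4, fibre_basis 5} = UNIV"
proof -
  have "v \<in> span {time_dir, fibre_basis 1, fibre_basis 2, fibre_basis 3, fibre_basis 4, fibre_basis 5}" for v
    by (subst solv_expansion) (intro span_add span_scale span_base; simp)
  then show ?thesis by auto
qed

lemma fibre_basis_independent:
  assumes "r1 *\<^sub>R fibre_basis 1 + r2 *\<^sub>R fibre_basis 2 + r3 *\<^sub>R fibre_basis 3 + r4 *\<^sub>R fibre_basis 4 + r5 *\<^sub>R fibre_basis 5 = 0"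
  shows "r1 = 0 \<and> r2 = 0 \<and> r3 = 0 \<and> r4 = 0 \<and> r5 = 0"
  using assms by (simp add: fibre_basis_simps complex_eq_iff zero_prod_def del: One_nat_def)

text \<open>What a symplectic form on the quotient provides after lifting: periods spanning the
  fibre directions and invariance under \<open>g_0\<close>. Only the span of \<open>Vs\<close> is
  prescribed; that the monodromy maps periods of the form to periods is derived from its
  invariance.\<close>

locale symplectic_cover =
  fixes c :: real and \<alpha> :: complex and \<omega> :: "solv \<Rightarrow> solv \<Rightarrow> solv \<Rightarrow> real" and Vs :: "solv list"
  assumes c: "c > 1" "(cmod \<alpha>)\<^sup>2 * c = 1"
    and C1: "C1 (\<omega> v w)"
    and bil: "bilinear (\<lambda>v w. \<omega> v w x)"
    and anti: "\<omega> v w x = - \<omega> w v x"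
    and closed: "dir_deriv (\<omega> v w) u x + dir_deriv (\<omega> w u) v x + dir_deriv (\<omega> u v) w x = 0"
    and nondegenerate: "\<forall>w. \<omega> v w x = 0 \<Longrightarrow> v = 0"
    and periodic: "V \<in> set Vs \<Longrightarrow> \<omega> v w (x + V) = \<omega> v w x"
    and monodromy: "\<omega> (monodromy c \<alpha> v) (monodromy c \<alpha> w) (time_dir + monodromy c \<alpha> x) = \<omega> v w x"
    and span_Vs: "span (set Vs) = {v. fst v = 0}"
begin

abbreviation "G \<equiv> monodromy c \<alpha>"
abbreviation "e \<equiv> fibre_basis"
abbreviation "T \<equiv> time_dir"

definition periods :: "solv set" where "periods = set Vs \<union> G ` set Vs"
text \<open>On fibre vectors this is the constant representative of the class of
  \<open>\<omega>\<close> on every fibre; the base point 0 does not matter there by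
  \<open>torus_mean_\<omega>_const\<close>. The remainder \<open>D\<close> becomes the exact
  part.\<close>

definition b :: "solv \<Rightarrow> solv \<Rightarrow> real" where "b v w = torus_mean Vs (\<omega> v w) 0"
definition D :: "solv \<Rightarrow> solv \<Rightarrow> solv \<Rightarrow> real" where "D v w x = \<omega> v w x - b v w"

lemma \<alpha>0: "\<alpha> \<noteq> 0" using c by auto

lemma blG: "bounded_linear G" by (rule bounded_linear_monodromy)
lemma linG: "linear G" by (rule bounded_linear.linear[OF blG])

lemma fst_G: "fst (G v) = fst v" by (simp add: monodromy_def)

lemma G_surj: "\<exists>y. v = G y"
  using c(1) \<alpha>0
  by (intro exI[of _ "(fst v, fst (snd v) / c, fst (snd (snd v)) / \<alpha>, - \<i> * snd (snd (snd v)))"])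
    (simp add: monodromy_def)

lemma span_GVs: "span (G ` set Vs) = span (set Vs)"
proof -
  have "G ` {v. fst v = 0} = {v. fst v = 0}"
  proof (intro Set.set_eqI iffI)
    fix v :: solv assume v: "v \<in> {v. fst v = 0}"
    obtain y where "v = G y" using G_surj by blast
    then show "v \<in> G ` {v. fst v = 0}" using v by (simp add: fst_G)
  qed (auto simp: fst_G)
  then show ?thesis
    using span_Vs by (simp add: linear_span_image[OF linG])
qed

lemma fst_Vs: "V \<in> set Vs \<Longrightarrow> fst V = 0"
  using span_Vs span_base by blast

lemma fst_periods: "V \<in> periods \<Longrightarrow> fst V = 0"
  unfolding periods_def by (elim UnE imageE) (simp_all add: fst_Vs fst_G)

text \<open>Writing \<open>x = T + G y\<close> turns a translation by \<open>G U\<close> at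
  \<open>x\<close> into the translation by \<open>U\<close> at \<open>y\<close>, to which invariance
  under the monodromy reduces it.\<close>

lemma \<omega>_periods: "V \<in> periods \<Longrightarrow> \<omega> v w (x + V) = \<omega> v w x"
proof (unfold periods_def, elim UnE imageE)
  fix U assume V: "V = G U" and U: "U \<in> set Vs"
  obtain y v' w' where y: "x - T = G y" "v = G v'" "w = G w'" using G_surj by meson
  have x: "x = T + G y" using y(1) by (simp add: algebra_simps)
  have "\<omega> v w (T + G (y + U)) = \<omega> v w (T + G y)"
    unfolding y monodromy by (rule periodic[OF U])
  then show "\<omega> v w (x + V) = \<omega> v w x"
    by (simp add: x V linear_add[OF linG] add.assoc)
qed (rule periodic)

text \<open>Cartan's formula for the closed form \<open>\<omega>\<close>: its time derivative is the
  exterior derivative of the one-form \<open>\<omega> T\<close>.\<close>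

lemma dir_deriv_time: "dir_deriv (\<omega> v w) T = (\<lambda>x. dir_deriv (\<omega> T w) v x - dir_deriv (\<omega> T v) w x)"
proof
  fix x
  have "\<omega> w T = (\<lambda>x. -1 * \<omega> T w x)" by (rule ext) (use anti[of w T] in simp)
  then have "dir_deriv (\<omega> w T) v x = - dir_deriv (\<omega> T w) v x"
    using dir_deriv_cmult[OF C1, of "-1" T w v] by simp
  then show "dir_deriv (\<omega> v w) T x = dir_deriv (\<omega> T w) v x - dir_deriv (\<omega> T v) w x"
    using closed[of v w T x] by simp
qed

text \<open>By Cartan's formula the time derivative is exact along the fibre, hence of mean zero.
  Along the fibre the mean is constant because the periods span it.\<close>

lemma torus_mean_\<omega>_const:
  assumes v: "fst v = 0" "fst w = 0"
  shows "torus_mean Vs (\<omega> v w) x = b v w"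
proof -
  have "torus_mean Vs (dir_deriv (\<omega> v w) T) x = 0" for x
  proof -
    show ?thesis
      using v span_Vs by (simp add: dir_deriv_time torus_mean_diff C1_cont_dir_deriv C1 torus_mean_dir_deriv_zero periodic)
  qed
  then have d: "dir_deriv (torus_mean Vs (\<omega> v w)) T = (\<lambda>x. 0)"
    by (simp add: dir_deriv_torus_mean C1 fun_eq_iff)
  have "\<forall>r. ((\<lambda>r. torus_mean Vs (\<omega> v w) (0 + r *\<^sub>R T)) has_real_derivative 0) (at r)"
    using C1_deriv[OF C1_torus_mean[OF C1], of Vs v w 0 T] d by simp
  then have "torus_mean Vs (\<omega> v w) (fst x *\<^sub>R T) = b v w"
    using DERIV_isconst_all[of "\<lambda>r. torus_mean Vs (\<omega> v w) (0 + r *\<^sub>R T)" "fst x" 0] by (simp add: b_def)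
  moreover have "x - fst x *\<^sub>R T \<in> span (set Vs)"
    by (simp add: span_Vs time_dir_def)
  from torus_mean_invariant[OF C1 periodic this, of v w "fst x *\<^sub>R T"]
  have "torus_mean Vs (\<omega> v w) x = torus_mean Vs (\<omega> v w) (fst x *\<^sub>R T)" by simp
  ultimately show ?thesis by simp
qed

lemma linear_\<omega>: "linear (\<lambda>w. \<omega> v w x)" "linear (\<lambda>v. \<omega> v w x)"
  using bil[of x] unfolding bilinear_def by blast+

lemma bil_b: "bilinear b"
  unfolding bilinear_def b_def by (intro conjI allI torus_mean_linear C1_cont C1 linear_\<omega>)

lemma anti_b: "b v w = - b w v"
proof -
  have "\<omega> v w = (\<lambda>x. -1 * \<omega> w v x)" by (rule ext) (use anti[of v w] in simp)
  then show ?thesis unfolding b_def by (metis torus_mean_cmult mult_minus1)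
qed

text \<open>Pulling back by \<open>g_0\<close> moves the mean to time 1 and to the basis
  \<open>map G Vs\<close>. Independence of the basis returns to \<open>Vs\<close>, and independence
  of time returns to the origin.\<close>

lemma b_G:
  assumes v: "fst v = 0" "fst w = 0"
  shows "b (G v) (G w) = b v w"
proof -
  have "b v w = torus_mean Vs (\<lambda>x. \<omega> (G v) (G w) (T + G x)) 0"
    by (simp add: b_def monodromy)
  also have "\<dots> = torus_mean (map G Vs) (\<omega> (G v) (G w)) (T + G 0)"
    by (simp add: torus_mean_affine[OF blG])
  also have "\<dots> = torus_mean Vs (\<omega> (G v) (G w)) (T + G 0)"
    by (subst torus_mean_basis[OF C1, of "map G Vs" Vs]) (auto intro: \<omega>_periods simp: periods_def span_GVs)
  also have "\<dots> = b (G v) (G w)"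
    by (rule torus_mean_\<omega>_const) (simp_all add: fst_G v)
  finally show ?thesis by simp
qed

lemma c_norm: "c * ((Re \<alpha>)\<^sup>2 + (Im \<alpha>)\<^sup>2) = 1"
  using c(2) by (simp add: cmod_power2 mult.commute)

lemma wedge_b_b: "wedge122 e a b b = 0"
  by (rule invariant_form_decomposable[OF bil_b anti_b _ c(1) c_norm, of G e, OF _ monodromy_fibre_basis])
    (simp add: b_G fst_fibre_basis)

lemma wedge_pullback:
  assumes "linear a" "bilinear B" "\<And>v w. B v w = - B w v" "bilinear C" "\<And>v w. C v w = - C w v"
  shows "wedge122 e (\<lambda>v. a (G v)) (\<lambda>v w. B (G v) (G w)) (\<lambda>v w. C (G v) (G w)) = wedge122 e a B C"
  using wedge122_pullback[OF assms, of G e, OF monodromy_fibre_basis] c_norm by simp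

lemma volume_nonzero: "wedge122 e (\<lambda>v. \<omega> T v x) (\<lambda>v w. \<omega> v w x) (\<lambda>v w. \<omega> v w x) \<noteq> 0"
  by (rule wedge122_nondegenerate[OF bil anti nondegenerate span_solv fibre_basis_independent])

lemma C1_D: "C1 (D v w)" and dir_deriv_D: "dir_deriv (D v w) u = dir_deriv (\<omega> v w) u"
  unfolding D_def[abs_def] by (simp_all add: C1_diff C1 C1_const dir_deriv_diff dir_deriv_const)

lemma D_G: "fst v = 0 \<Longrightarrow> fst w = 0 \<Longrightarrow> D (G v) (G w) (T + G x) = D v w x"
  by (simp add: D_def monodromy b_G)

lemma D_periods: "V \<in> periods \<Longrightarrow> D v w (x + V) = D v w x"
  by (simp add: D_def \<omega>_periods)

lemma anti_D: "D v w x = - D w v x"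
  using anti[of v w x] anti_b[of v w] by (simp add: D_def)

lemma bil_D: "bilinear (\<lambda>v w. D v w x)"
  using bil[of x] bil_b unfolding D_def bilinear_def by (auto intro: linear_compose_sub)

text \<open>A primitive is fixed at time 0 and transported by integrating \<open>\<omega> T\<close>
  in time; Cartan's formula keeps its fibre derivative equal to \<open>D\<close>. Composing
  \<open>\<zeta>\<close> with the projection to time 0 removes its own time dependence, so that the
  time derivative of \<open>\<eta>\<close> is exactly \<open>\<omega> T\<close>.\<close>

lemma primitive_D:
  obtains \<eta> where "\<And>v. C1 (\<eta> v)" "\<And>x. linear (\<lambda>v. \<eta> v x)" 
    "\<And>V v x. V \<in> periods \<Longrightarrow> \<eta> v (x + V) = \<eta> v x" "\<And>v. dir_deriv (\<eta> v) T = \<omega> T v"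
    "\<And>v w x. fst v = 0 \<Longrightarrow> fst w = 0 \<Longrightarrow> ext_deriv1 \<eta> v w x = D v w x"
proof -
  have "set Vs \<subseteq> periods" by (auto simp: periods_def)
  from primitive_minus_torus_mean[OF C1 linear_\<omega>(1) anti closed \<omega>_periods this]
  obtain \<zeta> where \<zeta>: "\<And>v. C1 (\<zeta> v)" "\<And>x. linear (\<lambda>v. \<zeta> v x)" 
    "\<And>V v x. V \<in> periods \<Longrightarrow> \<zeta> v (x + V) = \<zeta> v x"
    "\<And>v w x. ext_deriv1 \<zeta> v w x = \<omega> v w x - torus_mean Vs (\<omega> v w) x" by metis
  define \<pi> :: "solv \<Rightarrow> solv" where "\<pi> x = (0, snd x)" for x
  have \<pi>: "bounded_linear \<pi>"
    unfolding \<pi>_def[abs_def] by (intro bounded_linear_Pair bounded_linear_zero bounded_linear_snd)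
  define \<eta> where "\<eta> v x = \<zeta> v (\<pi> x) + time_int (\<omega> T v) x" for v x
  have 1: "C1 (\<lambda>x. \<zeta> v (\<pi> x))" "dir_deriv (\<lambda>x. \<zeta> v (\<pi> x)) u = (\<lambda>x. dir_deriv (\<zeta> v) (\<pi> u) (\<pi> x))" for v u
    using C1_affine[OF \<zeta>(1) \<pi>, of v 0] dir_deriv_affine[OF \<zeta>(1) \<pi>, of v 0 u] by simp_all
  have C1\<eta>: "C1 (\<eta> v)" for v
    unfolding \<eta>_def[abs_def] by (intro C1_add 1 C1_time_int C1)
  have dir_deriv_\<eta>: "dir_deriv (\<eta> v) u x = dir_deriv (\<zeta> v) (\<pi> u) (\<pi> x) + dir_deriv (time_int (\<omega> T v)) u x" for u v x
    unfolding \<eta>_def[abs_def] by (simp add: dir_deriv_add 1 C1_time_int C1)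
  show thesis
  proof (rule that[of \<eta>])
    show "C1 (\<eta> v)" for v by (fact C1\<eta>)
    show "linear (\<lambda>v. \<eta> v x)" for x
      unfolding \<eta>_def by (intro linear_compose_add \<zeta>(2) time_int_linear C1_cont C1 linear_\<omega>)
    show "\<eta> v (x + V) = \<eta> v x" if V: "V \<in> periods" for V v x
    proof -
      have "\<pi> (x + V) = \<pi> x + V" by (simp add: \<pi>_def prod_eq_iff fst_periods[OF V])
      moreover have "time_int (\<omega> T v) (x + V) = time_int (\<omega> T v) x"
      proof -
        have "(s * fst (x + V), snd (x + V)) = (s * fst x, snd x) + V" for s
          by (simp add: prod_eq_iff fst_periods[OF V])
        then show ?thesis
          unfolding time_int_def using \<omega>_periods[OF V] fst_periods[OF V] by simp
      qed
      ultimately show ?thesis by (simp add: \<eta>_def \<zeta>(3)[OF V])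
    qed
    have T: "T = (1, 0)" by (simp add: time_dir_def zero_prod_def)
    have dT: "dir_deriv (time_int (\<omega> T v)) T = \<omega> T v" for v
      unfolding T by (rule dir_deriv_time_int[OF C1])
    have "\<pi> T = 0" by (simp add: \<pi>_def T zero_prod_def)
    then show "dir_deriv (\<eta> v) T = \<omega> T v" for v
      using linear_0[OF linear_dir_deriv[OF \<zeta>(1)]] dT by (simp add: dir_deriv_\<eta> fun_eq_iff)
    show "ext_deriv1 \<eta> v w x = D v w x" if vw: "fst v = 0" "fst w = 0" for v w x
    proof -
      have \<pi>v: "\<pi> v = v" "\<pi> w = w" using vw by (simp_all add: \<pi>_def prod_eq_iff)
      have tv: "dir_deriv (time_int f) v = time_int (dir_deriv f v)" "dir_deriv (time_int f) w = time_int (dir_deriv f w)" if "C1 f" for f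
        using dir_deriv_time_int_fibre[OF that, of "snd v"] dir_deriv_time_int_fibre[OF that, of "snd w"] vw
        by (metis prod.collapse)+
      \<comment> \<open>The time integral yields the change of \<open>\<omega>\<close> since time 0;
        its value at time 0 then cancels against the derivative of \<open>\<zeta>\<close>
        there.\<close>
      have "time_int (dir_deriv (\<omega> T w) v) x - time_int (dir_deriv (\<omega> T v) w) x = time_int (dir_deriv (\<omega> v w) T) x"
        by (simp add: dir_deriv_time time_int_diff C1_cont_dir_deriv C1)
      also have "\<dots> = \<omega> v w x - \<omega> v w (\<pi> x)"
        unfolding T \<pi>_def by (rule time_int_dir_deriv[OF C1])
      finally have "ext_deriv1 \<eta> v w x = ext_deriv1 \<zeta> v w (\<pi> x) + \<omega> v w x - \<omega> v w (\<pi> x)"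
        by (simp add: ext_deriv1_def dir_deriv_\<eta> \<pi>v tv C1)
      then show ?thesis
        by (simp add: \<zeta>(4) torus_mean_\<omega>_const vw D_def)
    qed
  qed
qed

lemma contradiction: False
proof -
  obtain \<eta> where \<eta>: "\<And>v. C1 (\<eta> v)" "\<And>x. linear (\<lambda>v. \<eta> v x)" 
    "\<And>V v x. V \<in> periods \<Longrightarrow> \<eta> v (x + V) = \<eta> v x" "\<And>v. dir_deriv (\<eta> v) T = \<omega> T v"
    "\<And>v w x. fst v = 0 \<Longrightarrow> fst w = 0 \<Longrightarrow> ext_deriv1 \<eta> v w x = D v w x"
    using primitive_D by blast
  \<comment> \<open>The weight 1/3 is forced by the identity \<open>2 * (D \<and> C) + (D \<and> D)
    / 3 = \<omega> \<and> \<omega> - b \<and> b\<close> on fibre vectors, whose left side arises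
    below when the mean of \<open>f\<close> is differentiated.\<close>
  define C where "C v w x = b v w + (1 / 3) * D v w x" for v w x
  have C1_C: "C1 (C v w)" and dir_deriv_C: "dir_deriv (C v w) u = (\<lambda>x. (1 / 3) * dir_deriv (\<omega> v w) u x)" for v w u
    unfolding C_def[abs_def]
    by (simp_all add: C1_add C1_const C1_cmult C1_D dir_deriv_add dir_deriv_const dir_deriv_cmult dir_deriv_D del: times_divide_eq_left)
  have anti_C: "C v w x = - C w v x" for v w x
    using anti_b[of v w] anti_D[of v w x] by (simp add: C_def)
  have C_periods: "C v w (x + V) = C v w x" if "V \<in> periods" for v w x V
    by (simp add: C_def D_periods[OF that])
  have closed_C: "dir_deriv (C v w) u x + dir_deriv (C w u) v x + dir_deriv (C u v) w x = 0" for u v w x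
    using closed[of v w u x] by (simp add: dir_deriv_C)
  have closed_D: "dir_deriv (D v w) u x + dir_deriv (D w u) v x + dir_deriv (D u v) w x = 0" for u v w x
    using closed[of v w u x] by (simp add: dir_deriv_D)
  have bil_C: "bilinear (\<lambda>v w. C v w x)" for x
    using bil_D[of x] bil_b unfolding C_def bilinear_def
    by (intro conjI allI linear_compose_add; (elim conjE allE)?; (auto simp: linear_iff)[1])
  have Vs: "V \<in> set Vs \<Longrightarrow> V \<in> periods" for V
    by (simp add: periods_def)
  have e_span: "i \<in> {1..5} \<Longrightarrow> e i \<in> span (set Vs)" for i
    by (simp add: span_Vs fst_fibre_basis)
  note e0 = fst_fibre_basis
  \<comment> \<open>On the fibres \<open>D\<close> equals \<open>ext_deriv1 \<eta>\<close>. Writing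
    \<open>D\<close> keeps \<open>f\<close> differentiable, since \<open>\<eta>\<close> is only
    known to be \<open>C1\<close> and its exterior derivative only continuous.\<close>
  define f where "f x = wedge122 e (\<lambda>v. \<eta> v x) (\<lambda>v w. D v w x) (\<lambda>v w. C v w x)" for x
  have C1_f: "C1 f"
    unfolding f_def[abs_def] by (intro C1_wedge122 \<eta> C1_D C1_C)
  have f_periods: "f (x + V) = f x" if "V \<in> periods" for x V
    by (simp add: f_def \<eta>(3) D_periods C_periods that)
  have F_periodic: "torus_mean Vs f T = torus_mean Vs f 0"
  proof -
    \<comment> \<open>The pullback of \<open>\<eta>\<close> by \<open>g_0\<close>: a second
      primitive of \<open>D\<close> on the fibres, in general different from
      \<open>\<eta>\<close>.\<close>
    define \<eta>' where "\<eta>' v x = \<eta> (G v) (T + G x)" for v x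
    have f_mono: "f (T + G x) = wedge122 e (\<lambda>v. \<eta>' v x) (\<lambda>v w. D v w x) (\<lambda>v w. C v w x)" for x
    proof -
      have "f (T + G x) = wedge122 e (\<lambda>v. \<eta> (G v) (T + G x)) (\<lambda>v w. D (G v) (G w) (T + G x))
          (\<lambda>v w. C (G v) (G w) (T + G x))"
        unfolding f_def by (rule wedge_pullback[symmetric]; fact \<eta> bil_D anti_D bil_C anti_C)
      also have "\<dots> = wedge122 e (\<lambda>v. \<eta>' v x) (\<lambda>v w. D v w x) (\<lambda>v w. C v w x)"
        by (rule wedge122_cong) (simp_all add: \<eta>'_def C_def D_G b_G e0)
      finally show ?thesis .
    qed
    have C1_\<eta>': "C1 (\<eta>' v)" and dir_deriv_\<eta>': "dir_deriv (\<eta>' v) u = (\<lambda>x. dir_deriv (\<eta> (G v)) (G u) (T + G x))" for v u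
      unfolding \<eta>'_def[abs_def] by (intro C1_affine dir_deriv_affine \<eta> blG)+
    have \<eta>'_periodic: "\<eta>' v (x + V) = \<eta>' v x" if "V \<in> set Vs" for v x V
      using \<eta>(3)[of "G V" "G v" "T + G x"] that
      by (simp add: \<eta>'_def linear_add[OF linG] periods_def add.assoc)
    have ext_\<eta>': "ext_deriv1 \<eta>' v w x = D v w x" if "fst v = 0" "fst w = 0" for v w x
      using \<eta>(5)[of "G v" "G w" "T + G x"] that
      by (simp add: ext_deriv1_def dir_deriv_\<eta>' fst_G D_G)
    define \<zeta> where "\<zeta> v x = \<eta>' v x - \<eta> v x" for v x
    have C1_\<zeta>: "C1 (\<zeta> v)" for v
      unfolding \<zeta>_def[abs_def] by (intro C1_diff C1_\<eta>' \<eta>)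
    have ext_\<zeta>: "ext_deriv1 \<zeta> v w x = 0" if "fst v = 0" "fst w = 0" for v w x
      using ext_\<eta>'[of v w x] \<eta>(5)[of v w x] that
      unfolding ext_deriv1_def \<zeta>_def[abs_def] by (simp add: dir_deriv_diff C1_\<eta>' \<eta>)
    have "torus_mean Vs f T = torus_mean Vs f (T + G 0)"
      by (simp add: linear_0[OF linG])
    also have "\<dots> = torus_mean (map G Vs) f (T + G 0)"
      by (subst torus_mean_basis[OF C1_f, of "map G Vs" Vs]) (auto intro: f_periods simp: periods_def span_GVs)
    also have "\<dots> = torus_mean Vs (\<lambda>x. f (T + G x)) 0"
      by (simp add: torus_mean_affine[OF blG])
    finally have 1: "torus_mean Vs f T = torus_mean Vs (\<lambda>x. f (T + G x)) 0" .
    have "torus_mean Vs (\<lambda>x. f (T + G x) - f x) = torus_mean Vs (\<lambda>x. wedge122 e (\<lambda>v. \<zeta> v x) (\<lambda>v w. ext_deriv1 \<eta> v w x) (\<lambda>v w. C v w x))"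
    proof (rule arg_cong[where f = "torus_mean Vs"], rule ext)
      fix x
      have "f (T + G x) - f x = wedge122 e (\<lambda>v. \<zeta> v x) (\<lambda>v w. D v w x) (\<lambda>v w. C v w x)"
        unfolding f_mono unfolding f_def \<zeta>_def wedge122_def by (simp add: algebra_simps)
      also have "\<dots> = wedge122 e (\<lambda>v. \<zeta> v x) (\<lambda>v w. ext_deriv1 \<eta> v w x) (\<lambda>v w. C v w x)"
        by (rule wedge122_cong) (simp_all add: \<eta>(5) e0)
      finally show "f (T + G x) - f x = \<dots>" .
    qed
    \<comment> \<open>Integration by parts moves \<open>d\<close> from \<open>\<eta>\<close> to
      \<open>\<zeta>\<close>, where closedness on the fibres makes it vanish; exactness of
      \<open>\<zeta>\<close> is never claimed.\<close>
    also have "\<dots> = torus_mean Vs (\<lambda>x. wedge122 e (\<lambda>v. \<eta> v x) (\<lambda>v w. ext_deriv1 \<zeta> v w x) (\<lambda>v w. C v w x))"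
      by (rule torus_mean_wedge_by_parts[OF \<eta>(1) C1_\<zeta> C1_C anti_C closed_C])
        (simp_all add: \<eta>(3) \<zeta>_def \<eta>'_periodic C_periods Vs e_span)
    also have "\<dots> = torus_mean Vs (\<lambda>x. 0)"
    proof (rule arg_cong[where f = "torus_mean Vs"], rule ext)
      fix x
      have "wedge122 e (\<lambda>v. \<eta> v x) (\<lambda>v w. ext_deriv1 \<zeta> v w x) (\<lambda>v w. C v w x) =
        wedge122 e (\<lambda>v. \<eta> v x) (\<lambda>v w. 0) (\<lambda>v w. C v w x)"
        by (rule wedge122_cong) (simp_all add: ext_\<zeta> e0)
      then show "wedge122 e (\<lambda>v. \<eta> v x) (\<lambda>v w. ext_deriv1 \<zeta> v w x) (\<lambda>v w. C v w x) = 0"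
        by (simp add: wedge122_def wedge22_def)
    qed
    finally have "torus_mean Vs (\<lambda>x. f (T + G x) - f x) 0 = 0"
      by (simp add: torus_mean_const)
    then have "torus_mean Vs (\<lambda>x. f (T + G x)) 0 = torus_mean Vs f 0"
      using C1_cont[OF C1_affine[OF C1_f blG]] C1_cont[OF C1_f] by (simp add: torus_mean_diff)
    with 1 show ?thesis by simp
  qed
  define h where "h x = wedge122 e (\<lambda>v. \<omega> T v x) (\<lambda>v w. \<omega> v w x) (\<lambda>v w. \<omega> v w x)" for x
  have cont_h: "continuous_on UNIV h"
    unfolding h_def[abs_def] by (intro continuous_wedge122 C1_cont C1)
  have dF: "dir_deriv (torus_mean Vs f) T = torus_mean Vs h"
  proof -
    define \<beta> where "\<beta> v = \<omega> T v" for v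
    have C1_\<beta>: "C1 (\<beta> v)" for v unfolding \<beta>_def by (rule C1)
    have ext_\<beta>: "ext_deriv1 \<beta> v w x = dir_deriv (\<omega> v w) T x" for v w x
      by (simp add: dir_deriv_time ext_deriv1_def \<beta>_def)
    let ?W = "\<lambda>a B C x. wedge122 e (\<lambda>v. a v x) (\<lambda>v w. B v w x) (\<lambda>v w. C v w x)"
    have cW: "continuous_on UNIV (?W a B C)" if "\<And>v. continuous_on UNIV (a v)"
      "\<And>v w. continuous_on UNIV (B v w)" "\<And>v w. continuous_on UNIV (C v w)" for a B C
      by (rule continuous_wedge122[OF that])
    have cont: "continuous_on UNIV (?W \<beta> D C)" "continuous_on UNIV (?W \<beta> D D)" 
      "continuous_on UNIV (?W \<eta> (ext_deriv1 \<beta>) C)" "continuous_on UNIV (?W \<eta> (ext_deriv1 \<beta>) D)"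
      by (rule cW; (simp add: ext_\<beta>[abs_def])?; intro C1_cont C1_cont_dir_deriv C1_\<beta> \<eta> C1_D C1_C C1)+
    \<comment> \<open>As \<open>b\<close> is constant, the time derivative of \<open>D\<close> is
      that of \<open>\<omega>\<close>, namely \<open>d \<beta>\<close>, and the one of
      \<open>C\<close> is a third of it.\<close>
    have ddf: "dir_deriv f T = (\<lambda>x. ?W \<beta> D C x + ?W \<eta> (ext_deriv1 \<beta>) C x + (1 / 3) * ?W \<eta> (ext_deriv1 \<beta>) D x)"
    proof
      fix x
      have "wedge122 e (\<lambda>v. \<eta> v x) (\<lambda>v w. D v w x) (\<lambda>v w. (1 / 3) * ext_deriv1 \<beta> v w x) =
          (1 / 3) * ?W \<eta> (ext_deriv1 \<beta>) D x"
        unfolding wedge122_def wedge22_def by (simp add: algebra_simps)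
      then show "dir_deriv f T x = ?W \<beta> D C x + ?W \<eta> (ext_deriv1 \<beta>) C x + (1 / 3) * ?W \<eta> (ext_deriv1 \<beta>) D x"
        unfolding f_def[abs_def] dir_deriv_wedge122[OF \<eta>(1) C1_D C1_C] by (simp add: \<eta>(4) dir_deriv_D dir_deriv_C ext_\<beta> \<beta>_def)
    qed
    \<comment> \<open>Both terms containing \<open>d \<beta>\<close> are brought to the shape
      \<open>\<beta> \<and> D \<and> E\<close>: once with \<open>E = C\<close>, doubling the first
      term, and once with \<open>E = D\<close>.\<close>
    have parts: "torus_mean Vs (?W \<eta> (ext_deriv1 \<beta>) E) = torus_mean Vs (?W \<beta> D E)"
      if "\<And>v w. C1 (E v w)" "\<And>v w x. E v w x = - E w v x" 
        "\<And>u v w x. dir_deriv (E v w) u x + dir_deriv (E w u) v x + dir_deriv (E u v) w x = 0"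
        "\<And>V v w x. V \<in> periods \<Longrightarrow> E v w (x + V) = E v w x" for E
    proof -
      have "?W \<beta> D E x = ?W \<beta> (ext_deriv1 \<eta>) E x" for x
        by (rule wedge122_cong) (simp_all add: \<eta>(5) e0)
      moreover have "torus_mean Vs (?W \<beta> (ext_deriv1 \<eta>) E) = torus_mean Vs (?W \<eta> (ext_deriv1 \<beta>) E)"
        by (rule torus_mean_wedge_by_parts[OF \<eta>(1) C1_\<beta> that(1,2,3)])
          (simp_all add: \<eta>(3) \<beta>_def \<omega>_periods that(4) Vs e_span)
      ultimately show ?thesis by simp
    qed
    have pC: "torus_mean Vs (?W \<eta> (ext_deriv1 \<beta>) C) = torus_mean Vs (?W \<beta> D C)"
      by (rule parts) (fact C1_C anti_C closed_C C_periods)+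
    have pD: "torus_mean Vs (?W \<eta> (ext_deriv1 \<beta>) D) = torus_mean Vs (?W \<beta> D D)"
      by (rule parts) (fact C1_D anti_D closed_D D_periods)+
    have "dir_deriv (torus_mean Vs f) T = torus_mean Vs (dir_deriv f T)"
      by (rule dir_deriv_torus_mean[OF C1_f])
    also have "\<dots> = (\<lambda>x. torus_mean Vs (?W \<beta> D C) x + torus_mean Vs (?W \<eta> (ext_deriv1 \<beta>) C) x + (1 / 3) * torus_mean Vs (?W \<eta> (ext_deriv1 \<beta>) D) x)"
      unfolding ddf by (subst torus_mean_add, intro continuous_intros cont, intro continuous_intros cont,
        subst torus_mean_add, intro cont, intro cont, subst torus_mean_cmult, rule refl)
    also have "\<dots> = (\<lambda>x. 2 * torus_mean Vs (?W \<beta> D C) x + (1 / 3) * torus_mean Vs (?W \<beta> D D) x)"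
      by (simp add: pC pD)
    also have "\<dots> = torus_mean Vs (\<lambda>x. 2 * ?W \<beta> D C x + (1 / 3) * ?W \<beta> D D x)"
      by (subst torus_mean_add, intro continuous_intros cont, intro continuous_intros cont, simp only: torus_mean_cmult)
    also have "\<dots> = torus_mean Vs h"
    proof (rule arg_cong[where f = "torus_mean Vs"], rule ext)
      fix x
      have "h x = wedge122 e (\<lambda>v. \<beta> v x) (\<lambda>v w. b v w + D v w x) (\<lambda>v w. b v w + D v w x)"
        by (simp add: h_def \<beta>_def D_def)
      also have "\<dots> = wedge122 e (\<lambda>v. \<beta> v x) b b + (2 * ?W \<beta> D C x + (1 / 3) * ?W \<beta> D D x)"
        unfolding C_def wedge122_def wedge22_def by (simp add: algebra_simps)
      finally show "2 * ?W \<beta> D C x + (1 / 3) * ?W \<beta> D D x = h x"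
        by (simp add: wedge_b_b)
    qed
    finally show ?thesis .
  qed
  \<comment> \<open>The volume is continuous and without zeros on a connected space, so its fibre
    means cannot vanish by cancellation.\<close>
  have h_sign: "(\<forall>x. h x > 0) \<or> (\<forall>x. - h x > 0)"
  proof (rule ccontr)
    assume "\<not> ?thesis"
    then obtain x y where "h x \<le> 0" "h y \<ge> 0" by (auto simp: not_less)
    moreover have "connected (range h)"
      by (rule connected_continuous_image[OF cont_h connected_UNIV])
    ultimately have "0 \<in> range h"
      unfolding connected_iff_interval by blast
    then show False using volume_nonzero unfolding h_def by auto
  qed
  have torus_mean_h: "torus_mean Vs h x \<noteq> 0" for x
    using h_sign
  proof
    assume "\<forall>x. - h x > 0"
    then have "torus_mean Vs (\<lambda>x. - h x) x > 0" by (intro torus_mean_pos continuous_on_minus cont_h) auto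
    then show ?thesis using torus_mean_cmult[of Vs "-1" h] by simp
  next
    assume "\<forall>x. h x > 0"
    then have "torus_mean Vs h x > 0" by (intro torus_mean_pos cont_h) auto
    then show ?thesis by simp
  qed
  have d: "((\<lambda>r. torus_mean Vs f (0 + r *\<^sub>R T)) has_real_derivative torus_mean Vs h (0 + r *\<^sub>R T)) (at r)" for r
    using C1_deriv[OF C1_torus_mean[OF C1_f], of Vs 0 T r UNIV] by (simp add: dF)
  \<comment> \<open>Equal values of the mean of \<open>f\<close> at times 0 and 1 would force a zero
    of the mean of \<open>h\<close>.\<close>
  obtain r where "torus_mean Vs f (0 + 1 *\<^sub>R T) - torus_mean Vs f (0 + 0 *\<^sub>R T) = (1 - 0) * torus_mean Vs h (0 + r *\<^sub>R T)"
    using MVT2[of 0 1 "\<lambda>r. torus_mean Vs f (0 + r *\<^sub>R T)" "\<lambda>r. torus_mean Vs h (0 + r *\<^sub>R T)"] d by auto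
  with F_periodic torus_mean_h show False by simp
qed

end

section \<open>The lift of a tensor field to the covering space\<close>

definition C1_on :: "'a::euclidean_space set \<Rightarrow> ('a \<Rightarrow> 'b::euclidean_space) \<Rightarrow> bool" where
  "C1_on S f \<longleftrightarrow> (\<forall>x\<in>S. f differentiable (at x)) \<and>
     (\<forall>v. continuous_on S (\<lambda>x. frechet_derivative f (at x) v))"

lemma smooth_on_imp_C1_on:
  assumes "smooth_on S f" shows "C1_on S f"
proof -
  have "differentiable_of_order_on (Suc 0) f S" using assms unfolding smooth_on_def by blast
  then show ?thesis by (simp add: C1_on_def)
qed

lemma C1_on_has_derivative:
  "C1_on S f \<Longrightarrow> x \<in> S \<Longrightarrow> (f has_derivative frechet_derivative f (at x)) (at x)"
  unfolding C1_on_def by (simp add: frechet_derivative_works)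

lemma C1_on_continuous: "C1_on S f \<Longrightarrow> continuous_on S f"
  by (metis C1_on_has_derivative continuous_at_imp_continuous_on has_derivative_continuous)

lemma C1_onI:
  assumes "\<And>x. x \<in> S \<Longrightarrow> (f has_derivative f' x) (at x)" "\<And>v. continuous_on S (\<lambda>x. f' x v)"
  shows "C1_on S f"
proof -
  have "frechet_derivative f (at x) = f' x" if "x \<in> S" for x
    using frechet_derivative_at[OF assms(1)[OF that]] by simp
  then show ?thesis
    unfolding C1_on_def using assms by (auto simp: differentiable_def cong: continuous_on_cong)
qed

lemma C1_on_cong:
  assumes "C1_on S g" "\<And>x. x \<in> S \<Longrightarrow> f x = g x" "open S"
  shows "C1_on S f"
proof (rule C1_onI)
  show "(f has_derivative frechet_derivative g (at x)) (at x)" if "x \<in> S" for x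
    by (rule has_derivative_transform_within_open[OF C1_on_has_derivative[OF assms(1) that] assms(3) that])
      (simp add: assms(2))
  show "continuous_on S (\<lambda>x. frechet_derivative g (at x) v)" for v
    using assms(1) by (simp add: C1_on_def)
qed

lemma C1_on_mult:
  fixes f g :: "'a::euclidean_space \<Rightarrow> real"
  assumes "C1_on S f" "C1_on S g"
  shows "C1_on S (\<lambda>x. f x * g x)"
proof (rule C1_onI)
  show "((\<lambda>x. f x * g x) has_derivative
      (\<lambda>v. f x * frechet_derivative g (at x) v + frechet_derivative f (at x) v * g x)) (at x)" if "x \<in> S" for x
    by (intro has_derivative_mult C1_on_has_derivative[OF _ that] assms)
  show "continuous_on S (\<lambda>x. f x * frechet_derivative g (at x) v + frechet_derivative f (at x) v * g x)" for v
    using assms by (intro continuous_intros) (auto simp: C1_on_continuous, auto simp: C1_on_def)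
qed

lemma C1_on_inner:
  assumes "C1_on S f" shows "C1_on S (\<lambda>x. f x \<bullet> b)"
proof (rule C1_onI)
  show "((\<lambda>x. f x \<bullet> b) has_derivative (\<lambda>v. frechet_derivative f (at x) v \<bullet> b)) (at x)" if "x \<in> S" for x
    by (intro has_derivative_inner_left C1_on_has_derivative[OF _ that] assms)
  show "continuous_on S (\<lambda>x. frechet_derivative f (at x) v \<bullet> b)" for v
    using assms by (intro continuous_intros) (auto simp: C1_on_def)
qed

lemma C1_on_sum:
  assumes "\<And>i. i \<in> I \<Longrightarrow> C1_on S (f i)"
  shows "C1_on S (\<lambda>x. \<Sum>i\<in>I. f i x)"
proof (rule C1_onI)
  show "((\<lambda>x. \<Sum>i\<in>I. f i x) has_derivative (\<lambda>v. \<Sum>i\<in>I. frechet_derivative (f i) (at x) v)) (at x)" if "x \<in> S" for x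
    by (intro has_derivative_sum C1_on_has_derivative[OF _ that] assms)
  show "continuous_on S (\<lambda>x. \<Sum>i\<in>I. frechet_derivative (f i) (at x) v)" for v
    using assms by (intro continuous_intros) (auto simp: C1_on_def)
qed

text \<open>For functions read in a different chart at each point: near \<open>p\<close> the
  function agrees with one representative \<open>h p\<close>, so derivatives taken through different
  representatives coincide and continuity can be tested locally.\<close>

lemma
  fixes f :: "'a::euclidean_space \<Rightarrow> real"
  assumes V: "\<And>p. open (V p)" "\<And>p. p \<in> V p" "\<And>p. C1_on (V p) (h p)" "\<And>p q. q \<in> V p \<Longrightarrow> f q = h p q"
  shows C1_local: "C1 f" and dir_deriv_local: "dir_deriv f v p = frechet_derivative (h p) (at p) v"
proof -
  have d: "(f has_derivative frechet_derivative (h p) (at q)) (at q)" if "q \<in> V p" for p q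
    by (rule has_derivative_transform_within_open[OF C1_on_has_derivative[OF V(3) that] V(1) that])
      (simp add: V(4))
  define f' where "f' v x = frechet_derivative (h x) (at x) v" for v x
  have f': "f' v q = frechet_derivative (h p) (at q) v" if "q \<in> V p" for p q v
    unfolding f'_def using has_derivative_unique[OF d[OF that] d[OF V(2)]] by simp
  have c: "continuous_on UNIV f" "continuous_on UNIV (f' v)" for v
  proof -
    show "continuous_on UNIV f"
      using has_derivative_continuous[OF d[OF V(2)]] by (simp add: continuous_at_imp_continuous_on)
    have "continuous_on (V p) (f' v)" for p
      using V(3)[of p] f' unfolding C1_on_def by (simp cong: continuous_on_cong)
    then have "isCont (f' v) p" for p
      using V(1,2) continuous_on_eq_continuous_at by blast
    then show "continuous_on UNIV (f' v)" by (simp add: continuous_at_imp_continuous_on)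
  qed
  have l: "linear (\<lambda>v. f' v x)" for x
    unfolding f'_def using has_derivative_linear[OF d[OF V(2)]] by simp
  have r: "((\<lambda>r. f (x + r *\<^sub>R v)) has_real_derivative f' v x) (at 0)" for x v
  proof -
    have "((\<lambda>r. x + r *\<^sub>R v) has_derivative (\<lambda>r. r *\<^sub>R v)) (at (0::real))"
      by (auto intro!: derivative_eq_intros)
    moreover have "(f has_derivative (\<lambda>v. f' v x)) (at (x + 0 *\<^sub>R v))"
      unfolding f'_def using d[OF V(2)[of x]] by simp
    ultimately have "((\<lambda>r. f (x + r *\<^sub>R v)) has_derivative (\<lambda>r. f' (r *\<^sub>R v) x)) (at 0)"
      by (rule has_derivative_compose)
    then show ?thesis
      unfolding has_field_derivative_def linear_cmul[OF l] by (simp add: mult_commute_abs)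
  qed
  show "C1 f" "dir_deriv f v p = frechet_derivative (h p) (at p) v"
    using C1I[OF c l r] by (simp_all add: f'_def)
qed

section \<open>The lattice\<close>

lemma unimodular_left_inverse:
  fixes m :: "int ^ 3 ^ 3"
  assumes "det m = 1"
  obtains n :: "int ^ 3 ^ 3" where "n ** m = mat 1"
proof
  \<comment> \<open>The 2 by 2 minors from which the inverse is built; the witness is the adjugate
    of \<open>m\<close>.\<close>
  let ?a = "\<lambda>i j k l. m $ i $ j * m $ k $ l - m $ i $ l * m $ k $ j"
  show "(vector [vector [?a 2 2 3 3, ?a 3 2 1 3, ?a 1 2 2 3], vector [?a 3 1 2 3, ?a 1 1 3 3, ?a 2 1 1 3],
      vector [?a 2 1 3 2, ?a 3 1 1 2, ?a 1 1 2 2]] :: int ^ 3 ^ 3) ** m = mat 1"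
    using assms by (simp add: vec_eq_iff forall_3 matrix_matrix_mult_def sum_3 mat_def det_3 vector_3 algebra_simps)
qed

lemma eigenvector_left_inverse:
  fixes m n :: "int ^ 3 ^ 3" and x :: "'a::field ^ 3"
  assumes nm: "n ** m = mat 1" and "l \<noteq> 0"
    and eig: "\<And>j. l * x $ j = (\<Sum>k\<in>UNIV. of_int (m $ j $ k) * x $ k)"
  shows "inverse l * x $ i = (\<Sum>j\<in>UNIV. of_int (n $ i $ j) * x $ j)"
proof -
  have "l * (\<Sum>j\<in>UNIV. of_int (n $ i $ j) * x $ j) = (\<Sum>j\<in>UNIV. of_int (n $ i $ j) * (l * x $ j))"
    by (simp add: sum_distrib_left mult.left_commute)
  also have "\<dots> = (\<Sum>j\<in>UNIV. \<Sum>k\<in>UNIV. of_int (n $ i $ j * m $ j $ k) * x $ k)"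
    by (simp add: eig sum_distrib_left mult.assoc)
  also have "\<dots> = (\<Sum>k\<in>UNIV. of_int ((n ** m) $ i $ k) * x $ k)"
    by (subst sum.swap) (simp add: matrix_matrix_mult_def sum_distrib_right)
  also have "\<dots> = (\<Sum>k\<in>UNIV. if k = i then x $ k else 0)"
    unfolding nm by (intro sum.cong) (auto simp: mat_def)
  also have "\<dots> = x $ i"
    by simp
  finally show ?thesis using \<open>l \<noteq> 0\<close> by (simp add: field_simps)
qed

locale eigenlattice =
  fixes m :: "int ^ 3 ^ 3" and c :: real and \<alpha> :: complex and cv :: "real ^ 3" and av :: "complex ^ 3"
  assumes det: "det m = 1" and \<alpha>: "\<alpha> \<notin> \<real>" and c: "c > 1" and norm: "(cmod \<alpha>)\<^sup>2 * c = 1"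
    and cv: "cv \<noteq> 0" "\<And>j. c * cv $ j = (\<Sum>k\<in>UNIV. of_int (m $ j $ k) * cv $ k)"
    and av: "av \<noteq> 0" "\<And>j. \<alpha> * av $ j = (\<Sum>k\<in>UNIV. of_int (m $ j $ k) * av $ k)"
begin

lemma \<alpha>_nonzero: "\<alpha> \<noteq> 0" using \<alpha> by auto

definition eigen_lattice :: "(real \<times> complex) set" where
  "eigen_lattice = {(\<Sum>j\<in>UNIV. of_int (k j) * cv $ j, \<Sum>j\<in>UNIV. of_int (k j) * av $ j) |k. True}"

lemma lattice_add: "(u, z) \<in> eigen_lattice \<Longrightarrow> (u', z') \<in> eigen_lattice \<Longrightarrow> (u + u', z + z') \<in> eigen_lattice"
proof (unfold eigen_lattice_def, clarsimp)
  fix k k' :: "3 \<Rightarrow> int"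
  show "\<exists>l. (\<Sum>j\<in>UNIV. of_int (k j) * cv $ j) + (\<Sum>j\<in>UNIV. of_int (k' j) * cv $ j) = (\<Sum>j\<in>UNIV. of_int (l j) * cv $ j) \<and>
      (\<Sum>j\<in>UNIV. of_int (k j) * av $ j) + (\<Sum>j\<in>UNIV. of_int (k' j) * av $ j) = (\<Sum>j\<in>UNIV. of_int (l j) * av $ j)"
    by (intro exI[of _ "\<lambda>j. k j + k' j"]) (simp add: sum.distrib distrib_right)
qed

lemma lattice_minus: "(u, z) \<in> eigen_lattice \<Longrightarrow> (- u, - z) \<in> eigen_lattice"
proof (unfold eigen_lattice_def, clarsimp)
  fix k :: "3 \<Rightarrow> int"
  show "\<exists>l. - (\<Sum>j\<in>UNIV. of_int (k j) * cv $ j) = (\<Sum>j\<in>UNIV. of_int (l j) * cv $ j) \<and>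
      - (\<Sum>j\<in>UNIV. of_int (k j) * av $ j) = (\<Sum>j\<in>UNIV. of_int (l j) * av $ j)"
    by (intro exI[of _ "\<lambda>j. - k j"]) (simp add: sum_negf)
qed

text \<open>Multiplication by \<open>(s, t)\<close> acts on integer coefficients as a row vector
  times \<open>n\<close>. It is used for \<open>m\<close> with the factors \<open>c\<close>,
  \<open>\<alpha>\<close> and for the inverse of \<open>m\<close> with their reciprocals.\<close>

lemma lattice_matrix:
  fixes n :: "int ^ 3 ^ 3"
  assumes s: "\<And>i. s * cv $ i = (\<Sum>j\<in>UNIV. of_int (n $ i $ j) * cv $ j)"
    and t: "\<And>i. t * av $ i = (\<Sum>j\<in>UNIV. of_int (n $ i $ j) * av $ j)"
    and uz: "(u, z) \<in> eigen_lattice"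
  shows "(s * u, t * z) \<in> eigen_lattice"
proof -
  from uz obtain k where k: "u = (\<Sum>j\<in>UNIV. of_int (k j) * cv $ j)" "z = (\<Sum>j\<in>UNIV. of_int (k j) * av $ j)"
    by (auto simp: eigen_lattice_def)
  have *: "r * (\<Sum>i\<in>UNIV. of_int (k i) * x $ i) = (\<Sum>j\<in>UNIV. of_int (\<Sum>i\<in>UNIV. k i * n $ i $ j) * x $ j)"
    if "\<And>i. r * x $ i = (\<Sum>j\<in>UNIV. of_int (n $ i $ j) * x $ j)" for r and x :: "'b::field ^ 3"
  proof -
    have "r * (\<Sum>i\<in>UNIV. of_int (k i) * x $ i) = (\<Sum>i\<in>UNIV. of_int (k i) * (r * x $ i))"
      by (simp add: sum_distrib_left mult.left_commute)
    also have "\<dots> = (\<Sum>i\<in>UNIV. \<Sum>j\<in>UNIV. of_int (k i * n $ i $ j) * x $ j)"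
      by (simp add: that sum_distrib_left mult.assoc)
    also have "\<dots> = (\<Sum>j\<in>UNIV. of_int (\<Sum>i\<in>UNIV. k i * n $ i $ j) * x $ j)"
      by (subst sum.swap) (simp add: sum_distrib_right)
    finally show ?thesis .
  qed
  show ?thesis
    unfolding eigen_lattice_def k *[OF s] *[OF t]
    by (intro CollectI exI[of _ "\<lambda>j. \<Sum>i\<in>UNIV. k i * n $ i $ j"]) simp
qed

text \<open>At integer exponents the principal branch gives ordinary powers, so each induction step
  multiplies or divides once by the eigenvalues.\<close>

lemma lattice_powr:
  assumes "(u, z) \<in> eigen_lattice"
  shows "(c powr of_int n * u, \<alpha> powr of_int n * z) \<in> eigen_lattice"
proof (induction n rule: int_induct[where k = 0])
  case base
  show ?case using assms c \<alpha>_nonzero by simp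
next
  case (step1 i)
  have "(c * (c powr of_int i * u), \<alpha> * (\<alpha> powr of_int i * z)) \<in> eigen_lattice"
    by (rule lattice_matrix[OF cv(2) av(2) step1(2)])
  then show ?case using c \<alpha>_nonzero by (simp add: powr_add mult_ac)
next
  case (step2 i)
  obtain n :: "int ^ 3 ^ 3" where n: "n ** m = mat 1"
    using unimodular_left_inverse[OF det] .
  have "(inverse c * (c powr of_int i * u), inverse \<alpha> * (\<alpha> powr of_int i * z)) \<in> eigen_lattice"
    by (rule lattice_matrix[OF eigenvector_left_inverse[OF n _ cv(2)] eigenvector_left_inverse[OF n _ av(2)] step2(2)])
      (use c \<alpha>_nonzero in auto)
  then show ?case using c \<alpha>_nonzero by (simp add: powr_diff divide_inverse mult_ac)
qed

section \<open>Gaussian integers and an explicit group containing \<open>Gamma\<close>\<close>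

definition gauss :: "complex set" where "gauss = {Complex (of_int a) (of_int b) |a b. True}"

lemma gauss_add: "w \<in> gauss \<Longrightarrow> w' \<in> gauss \<Longrightarrow> w + w' \<in> gauss"
  by (auto simp: gauss_def complex_eq_iff) (metis of_int_add)+

lemma gauss_minus: "w \<in> gauss \<Longrightarrow> - w \<in> gauss"
  by (auto simp: gauss_def complex_eq_iff) (metis of_int_minus)+

lemma gauss_i: "w \<in> gauss \<Longrightarrow> \<i> * w \<in> gauss"
  by (auto simp: gauss_def complex_eq_iff) (metis of_int_minus)+

lemma exp_i_pi_half: "exp (\<i> * complex_of_real pi / 2) = \<i>"
  using cis_conv_exp[of "pi / 2"] by simp

lemma gauss_exp: "w \<in> gauss \<Longrightarrow> exp (\<i> * of_real (pi / 2 * of_int n)) * w \<in> gauss"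
proof (induction n rule: int_induct[where k = 0])
  case (step1 i)
  have "exp (\<i> * of_real (pi / 2 * of_int (i + 1))) = \<i> * exp (\<i> * of_real (pi / 2 * of_int i))"
    by (simp add: ring_distribs exp_add add_divide_distrib exp_i_pi_half)
  then show ?case using gauss_i[OF step1(2)[OF step1(3)]] by (simp add: mult_ac)
next
  case (step2 i)
  have "exp (\<i> * of_real (pi / 2 * of_int (i - 1))) = - \<i> * exp (\<i> * of_real (pi / 2 * of_int i))"
    by (simp add: ring_distribs exp_diff diff_divide_distrib exp_i_pi_half divide_i)
  then show ?case using gauss_minus[OF gauss_i[OF step2(2)[OF step2(3)]]] by (simp add: mult_ac)
qed simp

sublocale solv: group "Solv c \<alpha>"
  using group_Solv c \<alpha>_nonzero by simp

text \<open>An upper bound for \<open>Gamma\<close> with explicit coordinates; discreteness of the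
  larger group passes to \<open>Gamma\<close>.\<close>

definition lattice_group :: "solv set" where
  "lattice_group = {(of_int n, u, z, w) |n u z w. (u, z) \<in> eigen_lattice \<and> w \<in> gauss}"

lemma inv_Solv:
  "inv\<^bsub>Solv c \<alpha>\<^esub> (t, u, z, w) = (- t, - (c powr (- t) * u), - (\<alpha> powr of_real (- t) * z),
         - (exp (\<i> * of_real (pi / 2 * (- t))) * w))"
  by (rule solv.inv_equality) (use c \<alpha>_nonzero in \<open>auto simp: Solv_def\<close>)

lemma subgroup_lattice_group: "subgroup lattice_group (Solv c \<alpha>)"
proof (rule solv.subgroupI)
  have "(0, 0) \<in> eigen_lattice" "0 \<in> gauss"
    by (auto simp: eigen_lattice_def gauss_def complex_eq_iff intro!: exI[of _ "\<lambda>_. 0"] exI[of _ 0])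
  then have "(of_int 0, 0, 0, 0) \<in> lattice_group" unfolding lattice_group_def by blast
  then show "lattice_group \<noteq> {}" by blast
  show "lattice_group \<subseteq> carrier (Solv c \<alpha>)" by (simp add: Solv_def)
  fix x assume "x \<in> lattice_group"
  then obtain n u z w where x: "x = (of_int n, u, z, w)" "(u, z) \<in> eigen_lattice" "w \<in> gauss"
    by (auto simp: lattice_group_def)
  have "inv\<^bsub>Solv c \<alpha>\<^esub> x = (of_int (- n), - (c powr of_int (- n) * u), - (\<alpha> powr of_int (- n) * z),
      - (exp (\<i> * of_real (pi / 2 * of_int (- n))) * w))"
    by (simp add: x inv_Solv)
  then show "inv\<^bsub>Solv c \<alpha>\<^esub> x \<in> lattice_group"
    unfolding lattice_group_def using lattice_minus[OF lattice_powr[OF x(2), of "- n"]] gauss_minus[OF gauss_exp[OF x(3), of "- n"]]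
    by blast
  fix y assume "y \<in> lattice_group"
  then obtain n' u' z' w' where y: "y = (of_int n', u', z', w')" "(u', z') \<in> eigen_lattice" "w' \<in> gauss"
    by (auto simp: lattice_group_def)
  have "x \<otimes>\<^bsub>Solv c \<alpha>\<^esub> y = (of_int (n + n'), c powr of_int n * u' + u, \<alpha> powr of_int n * z' + z,
      exp (\<i> * of_real (pi / 2 * of_int n)) * w' + w)"
    by (simp add: x y Solv_def)
  then show "x \<otimes>\<^bsub>Solv c \<alpha>\<^esub> y \<in> lattice_group"
    unfolding lattice_group_def using lattice_add[OF lattice_powr[OF y(2), of n] x(2)] gauss_add[OF gauss_exp[OF y(3), of n] x(3)]
    by blast
qed

lemma Gamma_subset: "Gamma c \<alpha> cv av \<subseteq> lattice_group"
  unfolding Gamma_def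
proof (rule solv.generate_subgroup_incl[OF _ subgroup_lattice_group])
  have 0: "(0, 0) \<in> eigen_lattice"
    by (auto simp: eigen_lattice_def intro!: exI[of _ "\<lambda>_. 0"])
  have g: "0 \<in> gauss" "1 \<in> gauss" "\<i> \<in> gauss"
    unfolding gauss_def by (force simp: complex_eq_iff intro: exI[of _ 0] exI[of _ 1])+
  have l: "(cv $ j, av $ j) \<in> eigen_lattice" for j
    unfolding eigen_lattice_def
    by (auto intro!: exI[of _ "\<lambda>i. if i = j then 1 else 0"]
        simp: if_distrib[of "\<lambda>x. x * _"] if_distrib[of of_int] cong: if_cong)
  have i: "\<exists>n. (0::real) = of_int n" "\<exists>n. (1::real) = of_int n"
    by (metis of_int_0, metis of_int_1)
  show "{(1, 0, 0, 0)} \<union> range (\<lambda>j. (0, cv $ j, av $ j, 0)) \<union> {(0, 0, 0, 1), (0, 0, 0, \<i>)} \<subseteq> lattice_group"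
    unfolding lattice_group_def using 0 g l i by auto
qed

definition lattice_map :: "real ^ 3 \<Rightarrow> real \<times> complex" where
  "lattice_map k = (\<Sum>j\<in>UNIV. k $ j * cv $ j, \<Sum>j\<in>UNIV. of_real (k $ j) * av $ j)"

lemma linear_lattice_map: "linear lattice_map"
proof (rule linearI)
  fix r :: real and k
  show "lattice_map (r *\<^sub>R k) = r *\<^sub>R lattice_map k"
    by (simp add: lattice_map_def sum_distrib_left scaleR_sum_right mult.assoc scaleR_conv_of_real[where 'a = complex])
qed (simp_all add: lattice_map_def sum.distrib distrib_right)

text \<open>This amounts to real linear independence of the three vectors
  \<open>(c_j, \<alpha>_j)\<close>, obtained from the spectral data: applying \<open>m\<close> to a
  functional that vanishes on them separates its eigencomponents, each of which must then
  vanish.\<close>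

lemma surj_lattice_map: "surj lattice_map"
proof (rule ccontr)
  assume "\<not> surj lattice_map"
  then have "dim (range lattice_map) < DIM(real \<times> complex)"
    using dim_eq_full[of "range lattice_map"] dim_subset_UNIV[of "range lattice_map"] linear_subspace_image[OF linear_lattice_map subspace_UNIV] span_eq_iff
    by (metis le_neq_implies_less)
  then obtain y where y: "y \<noteq> 0" "\<And>x. x \<in> span (range lattice_map) \<Longrightarrow> orthogonal y x"
    using orthogonal_to_subspace_exists by metis
  obtain p q where pq: "y = (p, q)" by (cases y)
  have o: "p * cv $ j + Re (cnj q * av $ j) = 0" for j
  proof -
    have "lattice_map (axis j 1) = (cv $ j, av $ j)"
      by (simp add: lattice_map_def axis_def if_distrib[of "\<lambda>x. x * _"] if_distrib[of complex_of_real] cong: if_cong)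
    then have "orthogonal y (cv $ j, av $ j)"
      using y(2) span_base by (metis rangeI)
    then show ?thesis by (simp add: orthogonal_def pq inner_complex_def)
  qed
  have step: "(\<Sum>k\<in>UNIV. of_int (m $ j $ k) * (r * cv $ k + Re (s * av $ k))) = r * (c * cv $ j) + Re (s * (\<alpha> * av $ j))"
    for r s j
  proof -
    have "Re (s * (\<alpha> * av $ j)) = (\<Sum>k\<in>UNIV. of_int (m $ j $ k) * Re (s * av $ k))"
    proof -
      have "s * (\<Sum>k\<in>UNIV. of_int (m $ j $ k) * av $ k) = (\<Sum>k\<in>UNIV. of_real (of_int (m $ j $ k)) * (s * av $ k))"
        by (simp add: sum_distrib_left mult.left_commute)
      moreover have "Re (of_real r * z) = r * Re z" for r z by simp
      ultimately show ?thesis unfolding av(2) by (simp only: Re_sum)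
    qed
    then show ?thesis
      by (simp add: cv(2) sum_distrib_left sum.distrib distrib_left mult.left_commute)
  qed
  have o1: "p * (c * cv $ j) + Re (cnj q * (\<alpha> * av $ j)) = 0" for j
    using step[of j p "cnj q"] o by simp
  \<comment> \<open>Subtracting \<open>c\<close> times the relation \<open>o\<close> from
    \<open>o1\<close> eliminates the component \<open>p\<close>; this is the coefficient that
    remains.\<close>
  define s where "s = cnj q * (\<alpha> - of_real c)"
  have o2: "0 * cv $ j + Re (s * av $ j) = 0" for j
    using o1[of j] arg_cong[OF o[of j], of "\<lambda>x. c * x"] by (simp add: s_def algebra_simps)
  have o3: "Re (\<alpha> * (s * av $ j)) = 0" for j
    using step[of j 0 s] o2 by (simp add: mult_ac)
  have "Im \<alpha> \<noteq> 0" using \<alpha> complex_is_Real_iff by blast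
  \<comment> \<open>A complex number is zero if its real part and that of its product with the
    nonreal \<open>\<alpha>\<close> are both zero.\<close>
  then have "s * av $ j = 0" for j
    using o2[of j] o3[of j] by (simp add: complex_eq_iff)
  then have "s = 0" using av(1) by (auto simp: vec_eq_iff)
  moreover have "\<alpha> \<noteq> of_real c" using \<alpha> by auto
  ultimately have "q = 0" by (simp add: s_def)
  with o have "p * cv $ j = 0" for j by simp
  then have "p = 0" using cv(1) by (auto simp: vec_eq_iff)
  with \<open>q = 0\<close> y(1) pq show False by (simp add: zero_prod_def)
qed

text \<open>An injective linear map is bounded below, and a nonzero integer vector has norm at least
  1.\<close>

lemma lattice_discrete:
  obtains B where "B > 0" "\<And>u z. (u, z) \<in> eigen_lattice \<Longrightarrow> norm (u, z) < B \<Longrightarrow> u = 0 \<and> z = 0"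
proof -
  have "inj lattice_map"
    by (rule linear_surjective_imp_injective[OF linear_lattice_map surj_lattice_map]) (simp add: dim_UNIV)
  with linear_lattice_map obtain B where B: "B > 0" "\<And>k. B * norm k \<le> norm (lattice_map k)"
    using linear_inj_bounded_below_pos by blast
  have "u = 0 \<and> z = 0" if uz: "(u, z) \<in> eigen_lattice" "norm (u, z) < B" for u z
  proof -
    from uz obtain k :: "3 \<Rightarrow> int" where k: "(u, z) = lattice_map (\<chi> j. of_int (k j))"
      by (auto simp: eigen_lattice_def lattice_map_def)
    have "B * norm (\<chi> j. real_of_int (k j)) < B * 1"
      using B(2)[of "\<chi> j. of_int (k j)"] uz(2) k by simp
    then have "norm (\<chi> j. real_of_int (k j)) < 1"
      using B(1) mult_less_cancel_left_pos by blast
    then have "\<bar>real_of_int (k j)\<bar> < 1" for j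
      using component_le_norm_cart[of "\<chi> j. real_of_int (k j)" j] by simp
    then have "k j = 0" for j
      by (metis of_int_abs of_int_less_1_iff zabs_less_one_iff)
    with k show ?thesis by (simp add: lattice_map_def)
  qed
  with B(1) show thesis using that by blast
qed

abbreviation "proj \<equiv> M6_proj c \<alpha> cv av"

lemma generators_Gamma:
  "(1, 0, 0, 0) \<in> Gamma c \<alpha> cv av" "(0, cv $ j, av $ j, 0) \<in> Gamma c \<alpha> cv av"
  "(0, 0, 0, 1) \<in> Gamma c \<alpha> cv av" "(0, 0, 0, \<i>) \<in> Gamma c \<alpha> cv av"
  unfolding Gamma_def by (auto intro: generate.incl)

lemma subgroup_Gamma: "subgroup (Gamma c \<alpha> cv av) (Solv c \<alpha>)"
  unfolding Gamma_def by (rule solv.generate_is_subgroup) (simp add: Solv_def)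

lemma proj_mult: "\<gamma> \<in> Gamma c \<alpha> cv av \<Longrightarrow> proj (solv_mult c \<alpha> \<gamma> x) = proj x"
proof -
  assume \<gamma>: "\<gamma> \<in> Gamma c \<alpha> cv av"
  have U: "carrier (Solv c \<alpha>) = UNIV" by (simp add: Solv_def)
  have "Gamma c \<alpha> cv av #>\<^bsub>Solv c \<alpha>\<^esub> \<gamma> #>\<^bsub>Solv c \<alpha>\<^esub> x = Gamma c \<alpha> cv av #>\<^bsub>Solv c \<alpha>\<^esub> (\<gamma> \<otimes>\<^bsub>Solv c \<alpha>\<^esub> x)"
    by (rule solv.coset_mult_assoc) (simp_all add: U)
  moreover have "Gamma c \<alpha> cv av #>\<^bsub>Solv c \<alpha>\<^esub> \<gamma> = Gamma c \<alpha> cv av"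
    by (rule solv.coset_join2[OF _ subgroup_Gamma \<gamma>]) (simp add: U)
  ultimately show ?thesis by (simp add: M6_proj_def Solv_def)
qed

lemma proj_eqD:
  assumes "proj x = proj y"
  obtains n u z w where "(u, z) \<in> eigen_lattice" "w \<in> gauss" "y = solv_mult c \<alpha> (of_int n, u, z, w) x"
proof -
  have "y \<in> Gamma c \<alpha> cv av #>\<^bsub>Solv c \<alpha>\<^esub> y"
    by (rule solv.rcos_self[OF _ subgroup_Gamma]) (simp add: Solv_def)
  then have "y \<in> Gamma c \<alpha> cv av #>\<^bsub>Solv c \<alpha>\<^esub> x"
    using assms by (simp add: M6_proj_def)
  then obtain \<gamma> where "\<gamma> \<in> Gamma c \<alpha> cv av" "y = solv_mult c \<alpha> \<gamma> x"
    by (auto simp: r_coset_def Solv_def simp del: split_paired_Ex)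
  with Gamma_subset that show thesis by (auto simp: lattice_group_def)
qed

text \<open>One radius serves all points: an element with nonzero time component moves every point
  by at least 1, and one with time component zero acts as a translation, whose length does not
  depend on the point.\<close>

lemma proj_inj_on_ball:
  obtains \<epsilon> where "\<epsilon> > 0" "\<And>p. inj_on proj (ball p \<epsilon>)"
proof -
  obtain B where B: "B > 0" "\<And>u z. (u, z) \<in> eigen_lattice \<Longrightarrow> norm (u, z) < B \<Longrightarrow> u = 0 \<and> z = 0"
    using lattice_discrete by blast
  \<comment> \<open>Two points of a ball are less than \<open>2 * \<epsilon>\<close> apart. The
    bound 1 excludes nonzero integers and Gaussian integers, the bound \<open>B\<close> nonzero
    elements of \<open>eigen_lattice\<close>.\<close>
  define \<epsilon> where "\<epsilon> = min (1 / 2) (B / 2)"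
  have "inj_on proj (ball p \<epsilon>)" for p
  proof (rule inj_onI)
    fix x y assume xy: "x \<in> ball p \<epsilon>" "y \<in> ball p \<epsilon>" and "proj x = proj y"
    obtain n u z w where g: "(u, z) \<in> eigen_lattice" "w \<in> gauss" "y = solv_mult c \<alpha> (of_int n, u, z, w) x"
      using proj_eqD[OF \<open>proj x = proj y\<close>] .
    have "dist p x < \<epsilon>" "dist p y < \<epsilon>" using xy by auto
    then have "dist y x < 2 * \<epsilon>"
      using dist_triangle[of y x p] by (simp add: dist_commute)
    then have d: "norm (y - x) < 1" "norm (y - x) < B"
      by (auto simp: \<epsilon>_def dist_norm)
    obtain t' u' z' w' where x: "x = (t', u', z', w')" by (cases x)
    have "\<bar>of_int n\<bar> \<le> norm (y - x)"
      using norm_fst_le[of "fst (y - x)" "snd (y - x)"] by (simp add: g(3) x)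
    with d(1) have "n = 0" by linarith
    then have yx: "y - x = (0, u, z, w)"
      using c \<alpha>_nonzero by (simp add: g(3) x)
    have "norm (u, z) \<le> norm (y - x)"
      unfolding yx norm_Pair by simp
    with d(2) B(2)[OF g(1)] have "u = 0" "z = 0" by auto
    moreover have "norm w \<le> norm (y - x)"
      unfolding yx norm_Pair by (intro real_le_rsqrt) simp
    then have "norm w < 1" using d(1) by simp
    then have "\<bar>Re w\<bar> < 1" "\<bar>Im w\<bar> < 1"
      using abs_Re_le_cmod[of w] abs_Im_le_cmod[of w] by linarith+
    with g(2) have "w = 0"
      by (auto simp: gauss_def complex_eq_iff simp flip: of_int_abs)
    ultimately show "x = y" using yx by (simp add: zero_prod_def[symmetric])
  qed
  moreover have "\<epsilon> > 0" using B(1) by (simp add: \<epsilon>_def)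
  ultimately show thesis using that by blast
qed

definition lattice_basis :: "solv list" where
  "lattice_basis = [(0, cv $ 1, av $ 1, 0), (0, cv $ 2, av $ 2, 0), (0, cv $ 3, av $ 3, 0), (0, 0, 0, 1), (0, 0, 0, \<i>)]"

lemma span_lattice_basis: "span (set lattice_basis) = {v. fst v = 0}"
proof (rule subset_antisym)
  have "subspace {v :: solv. fst v = 0}"
    by (auto simp: subspace_def)
  then show "span (set lattice_basis) \<subseteq> {v. fst v = 0}"
    by (intro span_minimal) (auto simp: lattice_basis_def)
  show "{v. fst v = 0} \<subseteq> span (set lattice_basis)"
  proof
    fix v :: solv assume "v \<in> {v. fst v = 0}"
    then obtain u z w where v: "v = (0, u, z, w)" by (cases v) auto
    obtain k where k: "(u, z) = lattice_map k" using surj_lattice_map by (metis surjE)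
    have "v = k $ 1 *\<^sub>R (0, cv $ 1, av $ 1, 0) + k $ 2 *\<^sub>R (0, cv $ 2, av $ 2, 0) + k $ 3 *\<^sub>R (0, cv $ 3, av $ 3, 0)
        + Re w *\<^sub>R (0, 0, 0, 1) + Im w *\<^sub>R (0, 0, 0, \<i>)"
      using k by (simp add: v lattice_map_def sum_3 scaleR_conv_of_real[where 'a = complex] complex_eq_iff)
    also have "\<dots> \<in> span (set lattice_basis)"
      by (intro span_add span_scale span_base) (simp_all add: lattice_basis_def)
    finally show "v \<in> span (set lattice_basis)" .
  qed
qed

lemma proj_translation: "V \<in> set lattice_basis \<Longrightarrow> proj (x + V) = proj x"
proof -
  have *: "solv_mult c \<alpha> (0, r, a, b) x = x + (0, r, a, b)" for r a b
    using c \<alpha>_nonzero by (cases x) simp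
  show "V \<in> set lattice_basis \<Longrightarrow> proj (x + V) = proj x"
    using proj_mult[OF generators_Gamma(2), of 1 x] proj_mult[OF generators_Gamma(2), of 2 x]
      proj_mult[OF generators_Gamma(2), of 3 x] proj_mult[OF generators_Gamma(3), of x]
      proj_mult[OF generators_Gamma(4), of x]
    unfolding * by (auto simp: lattice_basis_def)
qed

lemma proj_monodromy: "proj (time_dir + monodromy c \<alpha> x) = proj x"
proof -
  have "solv_mult c \<alpha> (1, 0, 0, 0) x = time_dir + monodromy c \<alpha> x"
    using solv_mult_generators(1)[of c \<alpha>] c \<alpha>_nonzero
    by (cases x) (simp add: time_dir_def monodromy_def add.commute)
  then show ?thesis
    using proj_mult[OF generators_Gamma(1), of x] by simp
qed

end

section \<open>Charts given by local sections\<close>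

definition section_chart :: "('e \<Rightarrow> 'm) \<Rightarrow> 'e set \<Rightarrow> ('m, 'e) chart" where
  "section_chart \<pi> V = (\<pi> ` V, inv_into V \<pi>)"

lemma section_chart_simps:
  "chart_dom (section_chart \<pi> V) = \<pi> ` V" "chart_map (section_chart \<pi> V) = inv_into V \<pi>"
  by (simp_all add: section_chart_def chart_dom_def chart_map_def)

lemma chart_image_section_chart: "inj_on \<pi> V \<Longrightarrow> chart_image (section_chart \<pi> V) = V"
  by (simp add: chart_image_def section_chart_simps image_image)

text \<open>For \<open>q\<close> near \<open>p\<close> the point \<open>\<phi> q\<close> lies in
  \<open>V'\<close> over \<open>\<pi> q\<close>, and injectivity on \<open>V'\<close> allows only
  one such point. Hence the transition map is \<open>\<phi>\<close> near \<open>p\<close>.\<close>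

lemma transition_deriv_section_chart:
  fixes \<pi> :: "'e::euclidean_space \<Rightarrow> 'm"
  assumes V: "open V" "inj_on \<pi> V" "p \<in> V" and V': "open V'" "inj_on \<pi> V'" "\<phi> p \<in> V'"
    and \<phi>: "continuous_on UNIV \<phi>" "\<And>x. \<pi> (\<phi> x) = \<pi> x" "(\<phi> has_derivative \<phi>') (at p)"
  shows "transition_deriv (section_chart \<pi> V) (section_chart \<pi> V') (\<pi> p) = \<phi>'"
proof -
  let ?U = "V \<inter> \<phi> -` V'"
  have U: "open ?U" "p \<in> ?U"
    using V V' \<phi>(1) by (auto intro: open_vimage)
  have "\<phi> q = transition (section_chart \<pi> V) (section_chart \<pi> V') q" if q: "q \<in> ?U" for q
  proof -
    have "inv_into (\<pi> ` V) (inv_into V \<pi>) q = \<pi> q"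
      by (rule inv_into_f_eq) (use q V(2) in \<open>auto intro: inj_on_inv_into\<close>)
    moreover have "inv_into V' \<pi> (\<pi> q) = \<phi> q"
      by (rule inv_into_f_eq) (use q V'(2) \<phi>(2) in auto)
    ultimately show ?thesis
      by (simp add: transition_def section_chart_simps)
  qed
  then have "(transition (section_chart \<pi> V) (section_chart \<pi> V') has_derivative \<phi>') (at p)"
    by (rule has_derivative_transform_within_open[OF \<phi>(3) U])
  from frechet_derivative_at[OF this] show ?thesis
    using V by (simp add: transition_deriv_def section_chart_simps)
qed

theorem corollary3p4:
  fixes m :: "int ^ 3 ^ 3" and c :: real and \<alpha> :: complex
    and cv :: "real ^ 3" and av :: "complex ^ 3"
  assumes "det m = 1"
    and "\<alpha> \<notin> \<real>" and "c \<notin> \<rat>" and "c > 1" and "(cmod \<alpha>)\<^sup>2 * c = 1"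
    and "cv \<noteq> 0" and "\<And>j. c * cv $ j = (\<Sum>k\<in>UNIV. of_int (m $ j $ k) * cv $ k)"
    and "av \<noteq> 0" and "\<And>j. \<alpha> * av $ j = (\<Sum>k\<in>UNIV. of_int (m $ j $ k) * av $ k)"
  shows "\<not> admits_kaehler_metric (M6_atlas c \<alpha> cv av)"
proof
  interpret eigenlattice m c \<alpha> cv av
    by unfold_locales (fact assms)+
  let ?A = "M6_atlas c \<alpha> cv av"
  assume "admits_kaehler_metric ?A"
  then obtain J g where "kaehler_metric ?A J g" by (auto simp: admits_kaehler_metric_def)
  then have J: "smooth_endo_field ?A J" "\<And>\<kappa> p v. \<kappa> \<in> ?A \<Longrightarrow> p \<in> chart_image \<kappa> \<Longrightarrow> J \<kappa> p (J \<kappa> p v) = - v"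
    and g: "smooth_bilinear_field ?A g" "\<And>\<kappa> p v w. \<kappa> \<in> ?A \<Longrightarrow> p \<in> chart_image \<kappa> \<Longrightarrow> g \<kappa> p v w = g \<kappa> p w v"
      "\<And>\<kappa> p v. \<kappa> \<in> ?A \<Longrightarrow> p \<in> chart_image \<kappa> \<Longrightarrow> v \<noteq> 0 \<Longrightarrow> g \<kappa> p v v > 0"
      "\<And>\<kappa> p v w. \<kappa> \<in> ?A \<Longrightarrow> p \<in> chart_image \<kappa> \<Longrightarrow> g \<kappa> p (J \<kappa> p v) (J \<kappa> p w) = g \<kappa> p v w"
    and closed: "closed_2form ?A (fundamental_form J g)"
    unfolding kaehler_metric_def complex_structure_def almost_complex_structure_def hermitian_metric_def
      riemannian_metric_def by blast+
  obtain \<epsilon> where \<epsilon>: "\<epsilon> > 0" "\<And>p. inj_on proj (ball p \<epsilon>)"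
    using proj_inj_on_ball by blast
  define \<kappa> where "\<kappa> p = section_chart proj (ball p \<epsilon>)" for p
  have \<kappa>A: "\<kappa> p \<in> ?A" for p
    using \<epsilon>(2)[of p] by (auto simp: M6_atlas_def \<kappa>_def section_chart_def)
  have image_\<kappa>: "chart_image (\<kappa> p) = ball p \<epsilon>" for p
    using \<epsilon>(2) by (simp add: \<kappa>_def chart_image_section_chart)
  have p_ball: "p \<in> ball p \<epsilon>" for p using \<epsilon>(1) by simp
  have map_\<kappa>: "chart_map (\<kappa> p) (proj q) = q" "proj q \<in> chart_dom (\<kappa> p)" if "q \<in> ball p \<epsilon>" for p q
    using that \<epsilon>(2) by (simp_all add: \<kappa>_def section_chart_simps)
  have gbil: "bilinear (g (\<kappa> p) q)" and Jlin: "linear (J (\<kappa> p) q)"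
    and JJ: "J (\<kappa> p) q (J (\<kappa> p) q v) = - v" and gsym: "g (\<kappa> p) q v w = g (\<kappa> p) q w v"
    and gpos: "v \<noteq> 0 \<Longrightarrow> g (\<kappa> p) q v v > 0" and gJ: "g (\<kappa> p) q (J (\<kappa> p) q v) (J (\<kappa> p) q w) = g (\<kappa> p) q v w"
    if "q \<in> ball p \<epsilon>" for p q v w
    using that g J \<kappa>A image_\<kappa> by (auto simp: smooth_bilinear_field_def smooth_endo_field_def)
  have gC1: "C1_on (ball p \<epsilon>) (\<lambda>q. g (\<kappa> p) q v w)" for p v w
    using g(1) \<kappa>A image_\<kappa> unfolding smooth_bilinear_field_def by (metis smooth_on_imp_C1_on)
  have JC1: "C1_on (ball p \<epsilon>) (\<lambda>q. J (\<kappa> p) q v)" for p v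
    using J(1) \<kappa>A image_\<kappa> unfolding smooth_endo_field_def by (metis smooth_on_imp_C1_on)
  \<comment> \<open>Section charts use the coordinates of the covering space, so the components at
    \<open>p\<close> in the chart around \<open>p\<close> are already those of the lifted
    form.\<close>
  define \<omega> where "\<omega> v w p = fundamental_form J g (\<kappa> p) p v w" for v w p
  \<comment> \<open>Taking \<open>\<phi>\<close> to be the identity gives independence of the chart;
    taking it to be a deck transformation gives invariance of the lift.\<close>
  have transform: "fundamental_form J g (\<kappa> p) q v w = fundamental_form J g (\<kappa> p') (\<phi> q) (\<phi>' v) (\<phi>' w)"
    if q: "q \<in> ball p \<epsilon>" "\<phi> q \<in> ball p' \<epsilon>" and \<phi>: "continuous_on UNIV \<phi>" "\<And>x. proj (\<phi> x) = proj x"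
      "(\<phi> has_derivative \<phi>') (at q)" for p p' q v w \<phi> \<phi>'
  proof -
    have td: "transition_deriv (\<kappa> p) (\<kappa> p') (proj q) = \<phi>'"
      unfolding \<kappa>_def by (rule transition_deriv_section_chart[OF open_ball \<epsilon>(2) q(1) open_ball \<epsilon>(2) q(2) \<phi>])
    have "proj q = proj (\<phi> q)" by (simp add: \<phi>(2))
    then have x: "proj q \<in> chart_dom (\<kappa> p) \<inter> chart_dom (\<kappa> p')" "chart_map (\<kappa> p) (proj q) = q"
      "chart_map (\<kappa> p') (proj q) = \<phi> q"
      using map_\<kappa>[OF q(1)] map_\<kappa>[OF q(2)] by auto
    have gt: "g (\<kappa> p) q v w = g (\<kappa> p') (\<phi> q) (\<phi>' v) (\<phi>' w)" for v w
      using g(1) \<kappa>A x td unfolding smooth_bilinear_field_def by metis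
    have Jt: "\<phi>' (J (\<kappa> p) q v) = J (\<kappa> p') (\<phi> q) (\<phi>' v)" for v
      using J(1) \<kappa>A x td unfolding smooth_endo_field_def by metis
    show ?thesis by (simp add: fundamental_form_def gt Jt)
  qed
  have local: "\<omega> v w q = fundamental_form J g (\<kappa> p) q v w" if "q \<in> ball p \<epsilon>" for v w p q
    using transform[OF p_ball, of "\<lambda>x. x" q p "\<lambda>x. x" v w] that
    by (simp add: \<omega>_def continuous_on_id)
  have \<omega>_invariant: "\<omega> (\<phi>' v) (\<phi>' w) (\<phi> q) = \<omega> v w q"
    if "continuous_on UNIV \<phi>" "\<And>x. proj (\<phi> x) = proj x" "(\<phi> has_derivative \<phi>') (at q)" for v w \<phi> \<phi>' q
    using transform[OF p_ball p_ball that] by (simp add: \<omega>_def)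
  \<comment> \<open>The vector \<open>J (\<kappa> p) q v\<close> varies with \<open>q\<close>, while
    regularity of \<open>g\<close> is known for fixed arguments; expanding in the standard basis
    separates the two.\<close>
  have F: "C1_on (ball p \<epsilon>) (\<lambda>q. fundamental_form J g (\<kappa> p) q v w)" for p v w
  proof -
    have "C1_on (ball p \<epsilon>) (\<lambda>q. \<Sum>i\<in>Basis. (J (\<kappa> p) q v \<bullet> i) * g (\<kappa> p) q i w)"
      by (intro C1_on_sum C1_on_mult C1_on_inner gC1 JC1)
    moreover have "fundamental_form J g (\<kappa> p) q v w = (\<Sum>i\<in>Basis. (J (\<kappa> p) q v \<bullet> i) * g (\<kappa> p) q i w)"
      if "q \<in> ball p \<epsilon>" for q
    proof -
      have l: "linear (\<lambda>x. g (\<kappa> p) q x w)"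
        using gbil[OF that] by (auto simp: bilinear_def)
      have "g (\<kappa> p) q (\<Sum>i\<in>Basis. (J (\<kappa> p) q v \<bullet> i) *\<^sub>R i) w = (\<Sum>i\<in>Basis. (J (\<kappa> p) q v \<bullet> i) * g (\<kappa> p) q i w)"
        by (simp add: linear_sum[OF l] linear_cmul[OF l])
      then show ?thesis by (simp add: fundamental_form_def euclidean_representation)
    qed
    ultimately show ?thesis
      by (rule C1_on_cong) auto
  qed
  note loc = open_ball p_ball F local
  have dir_deriv_\<omega>: "dir_deriv (\<omega> v w) u p = frechet_derivative (\<lambda>q. fundamental_form J g (\<kappa> p) q v w) (at p) u" for v w u p
    by (rule dir_deriv_local[OF loc])
  interpret symplectic_cover c \<alpha> \<omega> lattice_basis
  proof
    show "c > 1" "(cmod \<alpha>)\<^sup>2 * c = 1" by fact+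
    show "C1 (\<omega> v w)" for v w by (rule C1_local[OF loc])
    show "bilinear (\<lambda>v w. \<omega> v w p)" for p
      using gbil[OF p_ball[of p]] Jlin[OF p_ball[of p]] linear_compose[OF Jlin[OF p_ball[of p]]]
      by (auto simp: bilinear_def \<omega>_def fundamental_form_def o_def)
    show "\<omega> v w p = - \<omega> w v p" for v w p
    proof -
      \<comment> \<open>Applying \<open>J\<close> to both arguments of \<open>g\<close> replaces
        \<open>J v\<close> by \<open>- v\<close> and \<open>w\<close> by \<open>J w\<close>.\<close>
      have "\<omega> v w p = g (\<kappa> p) p (- v) (J (\<kappa> p) p w)"
        by (simp add: \<omega>_def fundamental_form_def JJ[OF p_ball] flip: gJ[OF p_ball, of p "J (\<kappa> p) p v" w])
      also have "\<dots> = - \<omega> w v p"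
        by (simp add: bilinear_lneg[OF gbil[OF p_ball]] \<omega>_def fundamental_form_def gsym[OF p_ball, of p v])
      finally show ?thesis .
    qed
    show "dir_deriv (\<omega> v w) u p + dir_deriv (\<omega> w u) v p + dir_deriv (\<omega> u v) w p = 0" for u v w p
      using closed \<kappa>A[of p] p_ball[of p]
      unfolding closed_2form_def ext_deriv2_def dir_deriv_\<omega> by (simp add: image_\<kappa>)
    show "v = 0" if "\<forall>w. \<omega> v w p = 0" for v p
    proof -
      \<comment> \<open>The assumption is used with \<open>w = J v\<close>, where the fundamental
        form becomes the squared length of \<open>J v\<close>.\<close>
      have "g (\<kappa> p) p (J (\<kappa> p) p v) (J (\<kappa> p) p v) = 0"
        using that by (simp add: \<omega>_def fundamental_form_def)
      then have "J (\<kappa> p) p v = 0" using gpos[OF p_ball[of p], of "J (\<kappa> p) p v"] by force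
      then show "v = 0"
        using JJ[OF p_ball[of p], of v] linear_0[OF Jlin[OF p_ball[of p]]] by simp
    qed
    show "\<omega> v w (p + V) = \<omega> v w p" if "V \<in> set lattice_basis" for V v w p
      by (rule \<omega>_invariant[of "\<lambda>x. x + V" "\<lambda>x. x"])
        (auto intro!: continuous_intros derivative_eq_intros simp: proj_translation[OF that])
    show "\<omega> (monodromy c \<alpha> v) (monodromy c \<alpha> w) (time_dir + monodromy c \<alpha> p) = \<omega> v w p" for v w p
    proof (rule \<omega>_invariant)
      have G: "bounded_linear (monodromy c \<alpha>)" by (rule bounded_linear_monodromy)
      show "continuous_on UNIV (\<lambda>x. time_dir + monodromy c \<alpha> x)"
        by (intro continuous_intros bounded_linear.continuous_on[OF G])
      show "((\<lambda>x. time_dir + monodromy c \<alpha> x) has_derivative monodromy c \<alpha>) (at p)"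
        by (auto intro!: derivative_eq_intros bounded_linear.has_derivative[OF G])
    qed (rule proj_monodromy)
    show "span (set lattice_basis) = {v. fst v = 0}" by (rule span_lattice_basis)
  qed
  show False by (rule contradiction)
qed

end
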